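(* Let $\delta>0$ be arbitrary. If $d$ is a sufficiently large constant, then with high probability (as $n\to\infty$) $$\chi_g(H_{n,p;3})\leq d^{2/3+\delta},\qquad p=\frac{d}{n^{2}}.$$
   Context: $H_{n,p;3}$ is the random $3$-uniform hypergraph on vertex set $[n]$ in which each of the $\binom{n}{3}$ possible triples is an edge independently with probability $p$. "With high probability" means with probability tending to $1$ as $n\to\infty$. The coloring game on a hypergraph $H$ with $q$ colors: two players A and B (A moves first) alternately choose an uncolored vertex and assign it one of the colors $1,\dots,q$, such that the partial coloring remains proper, i.e. no edge has all of its vertices colored with the same color. A wins if eventually all vertices are colored; B wins if at some point the game cannot be completed (some uncolored vertex cannot be properly colored). The game chromatic number $\chi_g(H)$ is the minimum $q$ for which A has a winning strategy. *)

theory Defs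
  imports "HOL-Probability.Probability" "HOL-Probability.Product_PMF"
begin

definition uniform_edges :: "nat \<Rightarrow> nat \<Rightarrow> nat set set" where
  "uniform_edges r n = {e. e \<subseteq> {1..n} \<and> card e = r}"

definition random_hypergraph :: "nat \<Rightarrow> nat \<Rightarrow> real \<Rightarrow> nat set set pmf" where
  "random_hypergraph r n p =
     map_pmf (\<lambda>f. {e \<in> uniform_edges r n. f e})
       (Pi_pmf (uniform_edges r n) False (\<lambda>_. bernoulli_pmf p))"

definition proper_partial_coloring :: "'a set set \<Rightarrow> ('a \<rightharpoonup> nat) \<Rightarrow> bool" where
  "proper_partial_coloring E c \<longleftrightarrow> (\<forall>e\<in>E. \<not> (\<exists>k. \<forall>v\<in>e. c v = Some k))"

text \<open>A history of the game is the list of moves (vertex, color) made so far, most recent move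
  first, so that \<^term>\<open>map_of ms\<close> is the partial coloring reached after the history \<^term>\<open>ms\<close>, and
  the first player A is to move iff the length of \<^term>\<open>ms\<close> is even.\<close>

definition legal_move ::
  "'a set \<Rightarrow> 'a set set \<Rightarrow> nat \<Rightarrow> ('a \<times> nat) list \<Rightarrow> 'a \<times> nat \<Rightarrow> bool" where
  "legal_move V E q ms m \<longleftrightarrow>
     fst m \<in> V - dom (map_of ms) \<and> snd m \<in> {1..q} \<and> proper_partial_coloring E (map_of (m # ms))"

definition B_has_won :: "'a set \<Rightarrow> 'a set set \<Rightarrow> nat \<Rightarrow> ('a \<times> nat) list \<Rightarrow> bool" where
  "B_has_won V E q ms \<longleftrightarrow>
     (\<exists>v \<in> V - dom (map_of ms). \<forall>k. \<not> legal_move V E q ms (v, k))"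

definition all_colored :: "'a set \<Rightarrow> ('a \<times> nat) list \<Rightarrow> bool" where
  "all_colored V ms \<longleftrightarrow> V \<subseteq> dom (map_of ms)"

inductive consistent_history ::
  "'a set \<Rightarrow> 'a set set \<Rightarrow> nat \<Rightarrow> (('a \<times> nat) list \<Rightarrow> 'a \<times> nat) \<Rightarrow> ('a \<times> nat) list \<Rightarrow> bool"
  for V E q \<sigma> where
  start: "consistent_history V E q \<sigma> []"
| move_A: "consistent_history V E q \<sigma> ms \<Longrightarrow> \<not> B_has_won V E q ms \<Longrightarrow> even (length ms) \<Longrightarrow>
     legal_move V E q ms (\<sigma> ms) \<Longrightarrow> consistent_history V E q \<sigma> (\<sigma> ms # ms)"
| move_B: "consistent_history V E q \<sigma> ms \<Longrightarrow> \<not> B_has_won V E q ms \<Longrightarrow> odd (length ms) \<Longrightarrow>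
     legal_move V E q ms m \<Longrightarrow> consistent_history V E q \<sigma> (m # ms)"

text \<open>Every move colors a new vertex, so on a finite vertex set a play in which B never wins and
  A always has a legal answer ends with all vertices colored.\<close>

definition winning_strategy_A ::
  "'a set \<Rightarrow> 'a set set \<Rightarrow> nat \<Rightarrow> (('a \<times> nat) list \<Rightarrow> 'a \<times> nat) \<Rightarrow> bool" where
  "winning_strategy_A V E q \<sigma> \<longleftrightarrow>
     (\<forall>ms. consistent_history V E q \<sigma> ms \<longrightarrow>
        \<not> B_has_won V E q ms \<and>
        (even (length ms) \<and> \<not> all_colored V ms \<longrightarrow> legal_move V E q ms (\<sigma> ms)))"

definition game_chromatic_number :: "'a set \<Rightarrow> 'a set set \<Rightarrow> nat" where
  "game_chromatic_number V E = (LEAST q. \<exists>\<sigma>. winning_strategy_A V E q \<sigma>)"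

lemma maximal_history_all_colored:
  assumes w: "winning_strategy_A V E q \<sigma>" and c: "consistent_history V E q \<sigma> ms"
    and m: "\<And>m. \<not> consistent_history V E q \<sigma> (m # ms)"
  shows "all_colored V ms"
proof (rule ccontr)
  assume n: "\<not> all_colored V ms"
  then obtain v where v: "v \<in> V - dom (map_of ms)" by (auto simp: all_colored_def)
  have b: "\<not> B_has_won V E q ms" using w c by (auto simp: winning_strategy_A_def)
  then obtain k where k: "legal_move V E q ms (v, k)" using v unfolding B_has_won_def by blast
  show False
  proof (cases "even (length ms)")
    case True
    then have "legal_move V E q ms (\<sigma> ms)" using w c n by (auto simp: winning_strategy_A_def)
    then show False using m consistent_history.move_A[OF c b True] by blast
  next
    case False
    then show False using m consistent_history.move_B[OF c b False k] by blast
  qed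
qed

text \<open>The minimum is attained: with one color per vertex A wins whenever every edge has at least
  two vertices.\<close>

lemma consistent_history_proper:
  assumes "consistent_history V E q \<sigma> ms" and "{} \<notin> E"
  shows "proper_partial_coloring E (map_of ms) \<and> distinct (map fst ms) \<and> fst ` set ms \<subseteq> V"
  using assms
  by (induction rule: consistent_history.induct)
     (auto simp: proper_partial_coloring_def legal_move_def dom_map_of_conv_image_fst)

lemma winning_strategy_A_exists:
  fixes V :: "'a set"
  assumes fin: "finite V" and two: "\<And>e. e \<in> E \<Longrightarrow> 2 \<le> card e"
  shows "\<exists>q \<sigma>. winning_strategy_A V E q \<sigma>"
proof -
  let ?q = "card V"
  have ne: "{} \<notin> E" using two by force
  have ext: "\<exists>k. legal_move V E ?q ms (v, k)"
    if c: "consistent_history V E ?q \<sigma> ms" and v: "v \<in> V - dom (map_of ms)" for \<sigma> ms v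
  proof -
    note p = consistent_history_proper[OF c ne]
    have "fst ` set ms \<subset> V" using p v by (auto simp: dom_map_of_conv_image_fst)
    then have "card (fst ` set ms) < ?q" using fin by (simp add: psubset_card_mono)
    moreover have "card (fst ` set ms) = length ms"
      using p by (metis distinct_card length_map list.set_map)
    ultimately have "card (snd ` set ms) < card {1..?q}"
      using card_length[of "map snd ms"] by simp
    then obtain k where k: "k \<in> {1..?q}" "k \<notin> snd ` set ms"
      by (metis card_mono finite_imageI finite_set not_less subsetI)
    have "proper_partial_coloring E (map_of ((v, k) # ms))"
      unfolding proper_partial_coloring_def
    proof (intro ballI notI)
      fix e assume e: "e \<in> E" and "\<exists>j. \<forall>u\<in>e. map_of ((v, k) # ms) u = Some j"
      then obtain j where j: "\<And>u. u \<in> e \<Longrightarrow> map_of ((v, k) # ms) u = Some j" by blast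
      have "\<not> e \<subseteq> {v}"
        using two[OF e] card_mono[of "{v}" e] by auto
      then obtain u where u: "u \<in> e" "u \<noteq> v" by auto
      then have mu: "map_of ms u = Some j" using j[of u] by simp
      then have "j \<in> snd ` set ms" by (force dest: map_of_SomeD)
      then have "v \<notin> e" using j[of v] k by auto
      then have "\<forall>u\<in>e. map_of ms u = Some j" using j by (metis map_of_Cons_code(2) \<open>v \<notin> e\<close>)
      then show False using p e unfolding proper_partial_coloring_def by blast
    qed
    then show ?thesis using k v by (auto simp: legal_move_def)
  qed
  define \<sigma> :: "('a \<times> nat) list \<Rightarrow> 'a \<times> nat" where "\<sigma> = (\<lambda>ms. SOME m. legal_move V E ?q ms m)"
  have "winning_strategy_A V E ?q \<sigma>"
    unfolding winning_strategy_A_def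
  proof (intro allI impI conjI)
    fix ms assume c: "consistent_history V E ?q \<sigma> ms"
    show "\<not> B_has_won V E ?q ms" using ext[OF c] by (auto simp: B_has_won_def)
    assume "even (length ms) \<and> \<not> all_colored V ms"
    then obtain v where "v \<in> V - dom (map_of ms)" by (auto simp: all_colored_def)
    with ext[OF c] obtain m where "legal_move V E ?q ms m" by blast
    then show "legal_move V E ?q ms (\<sigma> ms)" unfolding \<sigma>_def by (rule someI)
  qed
  then show ?thesis by blast
qed

end

theory Submission
  imports Defs "HOL-Real_Asymp.Real_Asymp"
begin

text \<open>
  A plays in stages; a stage lasts as long as some uncolored vertex has at least \<open>24 r\<close> of the
  \<open>q \<ge> 64 r\<close> colors blocked. Whatever the coloring, only \<open>O(n / r)\<close> vertices can have that many blocked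
  colors (union bound over all colorings), so as long as A only colors such vertices, or boundedly
  more, a stage has length \<open>O(n / r)\<close>. Every color that becomes blocked at \<open>v\<close> during the stage costs
  a move at a neighbor of \<open>v\<close>, and only \<open>O(n / r\<^sup>2)\<close> vertices see \<open>8 r\<close> moves of the stage in their
  neighborhood. These are protected, together with every vertex that shares too many neighbors
  with protected ones. A set of \<open>O(n / r\<^sup>2)\<close> vertices typically has \<open>O(d\<^sup>2 / r\<^sup>2)\<close> such overlaps per
  vertex, which is less than \<open>r\<close> exactly because \<open>r\<close> exceeds \<open>d\<close> to the power \<open>2/3\<close>; hence the
  protected set stays small. As it is closed, every newly protected vertex has few overlaps with the
  older ones, and within one batch of new vertices a degeneracy order does the same. So the
  activation strategy, which gives priority to older vertices, lets each protected vertex be touched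
  only \<open>O(r)\<close> times before A colors it.
\<close>

section \<open>The activation strategy\<close>

text \<open>B adapts to everything seen so far, so no estimate may refer to one particular play:
  each sparsity property is required for all colorings or all vertex sets at once, and the union
  bound pays for it. A circularity has to be cut: the length of a stage depends on the number of
  protected vertices and conversely. As long as the protected set respects the cap \<open>L\<close>,
  the stage is short enough to justify fewer than \<open>2 * m\<^sub>2 \<le> L\<close> protected
  vertices, so the cap never binds. Moreover the priority list grows online and cannot be reordered,
  because the touches already counted depend on it; new vertices are appended, which is why the old
  list must be closed under large overlaps. The color budget of a vertex is fewer than
  \<open>24 * r\<close> colors blocked when the stage opens, about \<open>8 * r\<close> touches
  before it is protected, fewer than \<open>2 * (8 * r)\<close> touches in overlaps and boundedly
  many others. The 24 splits into 8 for colors with large classes, of which there are few, and 16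
  for the rest.\<close>

definition nbrs :: "'a set set \<Rightarrow> 'a \<Rightarrow> 'a set" where
  "nbrs E v = {x. x \<noteq> v \<and> (\<exists>e\<in>E. v \<in> e \<and> x \<in> e)}"

text \<open>The color of \<open>v\<close> itself is ignored, so the set makes sense for colored
  vertices too and only grows during the game. A vertex that was endangered when A colored it
  therefore still counts as endangered later.\<close>

definition blocked :: "'a set set \<Rightarrow> nat \<Rightarrow> ('a \<rightharpoonup> nat) \<Rightarrow> 'a \<Rightarrow> nat set" where
  "blocked E q c v = {k \<in> {1..q}. \<exists>e\<in>E. v \<in> e \<and> (\<forall>u\<in>e - {v}. c u = Some k)}"

text \<open>Moves inside an overlap are not tracked one by one; together they block at most as many
  colors as the overlap has elements. Removing \<open>v\<close> from \<open>S\<close> matters: every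
  neighbor of \<open>v\<close> is adjacent to \<open>v\<close>, so otherwise
  \<open>v \<in> S\<close> would make the overlap the whole neighborhood.\<close>

definition overlap :: "'a set set \<Rightarrow> 'a \<Rightarrow> 'a set \<Rightarrow> 'a set" where
  "overlap E v S = {x \<in> nbrs E v. \<exists>u\<in>S - {v}. x = u \<or> x \<in> nbrs E u}"

lemma nbrs_sym: "x \<in> nbrs E v \<Longrightarrow> v \<in> nbrs E x"
  by (auto simp: nbrs_def)

lemma not_in_own_nbrs [simp]: "v \<notin> nbrs E v"
  by (simp add: nbrs_def)

lemma overlap_mono: "S \<subseteq> T \<Longrightarrow> overlap E v S \<subseteq> overlap E v T"
  by (auto simp: overlap_def)

lemma overlap_Un: "overlap E v (S \<union> T) = overlap E v S \<union> overlap E v T"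
  by (auto simp: overlap_def)

lemma overlap_empty [simp]: "overlap E v {} = {}"
  by (simp add: overlap_def)

lemma overlap_remove: "overlap E v (S - {v}) = overlap E v S"
  by (simp add: overlap_def)

lemma finite_blocked [simp]: "finite (blocked E q c v)"
  by (simp add: blocked_def)

lemma blocked_mono:
  assumes "c \<subseteq>\<^sub>m c'"
  shows "blocked E q c v \<subseteq> blocked E q c' v"
proof -
  have "c' u = Some k" if "c u = Some k" for u k
    using assms that by (metis domI map_le_def)
  then show ?thesis unfolding blocked_def by blast
qed

text \<open>A color newly blocked at \<open>v\<close> needs an edge through \<open>v\<close> and the
  vertex just colored. Within a stage only such touches are counted; that the rest of the edge has
  to be monochromatic is exploited only when endangered vertices are counted.\<close>

lemma blocked_update:
  "blocked E q (c(u \<mapsto> k)) v \<subseteq> blocked E q c v \<union> (if u \<in> nbrs E v then {k} else {})"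
proof
  fix j assume j: "j \<in> blocked E q (c(u \<mapsto> k)) v"
  then obtain e where e: "e \<in> E" "v \<in> e" "\<forall>x\<in>e - {v}. (c(u \<mapsto> k)) x = Some j" "j \<in> {1..q}"
    by (auto simp: blocked_def)
  show "j \<in> blocked E q c v \<union> (if u \<in> nbrs E v then {k} else {})"
  proof (cases "u \<in> e - {v}")
    case True
    then have "u \<in> nbrs E v" using e by (auto simp: nbrs_def)
    moreover have "j = k" using bspec[OF e(3) True] by simp
    ultimately have "u \<in> nbrs E v" "j = k" by auto
    then show ?thesis by simp
  next
    case False
    then have "\<forall>x\<in>e - {v}. c x = Some j" using e(3) by (metis fun_upd_other)
    then show ?thesis using e by (auto simp: blocked_def)
  qed
qed

lemma card_blocked_update:
  "card (blocked E q (c(u \<mapsto> k)) v) \<le> card (blocked E q c v) + (if u \<in> nbrs E v then 1 else 0)"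
proof -
  have "card (blocked E q (c(u \<mapsto> k)) v)
      \<le> card (blocked E q c v \<union> (if u \<in> nbrs E v then {k} else {}))"
    by (rule card_mono[OF _ blocked_update]) simp
  also have "\<dots> \<le> card (blocked E q c v) + card (if u \<in> nbrs E v then {k} else {})"
    by (rule card_Un_le)
  finally show ?thesis by (simp split: if_splits)
qed

text \<open>The list is built from its end: among the vertices not yet placed, one with small
  overlap goes last, and the vertices that remain become its predecessors.\<close>

lemma exists_degenerate_list:
  assumes "finite S"
    and "\<And>S'. S' \<subseteq> S \<Longrightarrow> S' \<noteq> {} \<Longrightarrow> \<exists>v\<in>S'. card (overlap E v S') < g"
  shows "\<exists>zs. distinct zs \<and> set zs = S \<and>
    (\<forall>i<length zs. card (overlap E (zs ! i) (set (take i zs))) < g)"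
  using assms(1,2)
proof (induction S rule: finite_remove_induct)
  case empty
  then show ?case by (intro exI[of _ "[]"]) simp
next
  case (remove S)
  from remove.prems[of S] remove.hyps obtain v where v: "v \<in> S" "card (overlap E v S) < g" by blast
  have "\<exists>v\<in>S'. card (overlap E v S') < g" if "S' \<subseteq> S - {v}" "S' \<noteq> {}" for S'
    using that by (intro remove.prems) auto
  from remove.IH[OF v(1) this] obtain zs where zs: "distinct zs" "set zs = S - {v}"
    "\<forall>i<length zs. card (overlap E (zs ! i) (set (take i zs))) < g"
    by auto
  have "card (overlap E ((zs @ [v]) ! i) (set (take i (zs @ [v])))) < g"
    if "i < length (zs @ [v])" for i
  proof (cases "i < length zs")
    case True
    then show ?thesis using zs by (simp add: nth_append)
  next
    case False
    then have "i = length zs" using that by simp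
    then show ?thesis using zs(2) v by (simp add: overlap_remove)
  qed
  moreover have "distinct (zs @ [v])" "set (zs @ [v]) = S" using zs v by auto
  ultimately show ?case by blast
qed

text \<open>The protected vertices are listed by decreasing priority, and \<open>U\<close> is the set of uncolored
  vertices. A vertex outside \<open>overlap E v (earlier vertices)\<close> touches \<open>v\<close> without A being distracted
  by a vertex of higher priority; such touches are what \<open>guarded\<close> counts.\<close>

definition guarded :: "'a set set \<Rightarrow> nat \<Rightarrow> 'a list \<Rightarrow> 'a set \<Rightarrow> 'a set \<Rightarrow> nat \<Rightarrow> nat \<Rightarrow> bool" where
  "guarded E b zs act T x i \<longleftrightarrow>
     card (nbrs E (zs ! i) \<inter> T - overlap E (zs ! i) (set (take i zs)))
       \<le> b + (if zs ! i \<in> act then 1 else 0) + x"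

lemma guarded_insert_overlap:
  assumes "guarded E b zs act T x i"
    and "u \<in> nbrs E (zs ! i) \<Longrightarrow> u \<in> overlap E (zs ! i) (set (take i zs))"
  shows "guarded E b zs act (insert u T) x i"
proof -
  have "nbrs E (zs ! i) \<inter> insert u T - overlap E (zs ! i) (set (take i zs))
      = nbrs E (zs ! i) \<inter> T - overlap E (zs ! i) (set (take i zs))"
    using assms(2) by auto
  then show ?thesis using assms(1) by (simp add: guarded_def)
qed

lemma guarded_insert:
  assumes "guarded E b zs act T 0 i"
  shows "guarded E b zs act (insert u T) 1 i"
proof -
  let ?K = "overlap E (zs ! i) (set (take i zs))"
  have "card (nbrs E (zs ! i) \<inter> insert u T - ?K) \<le> card (insert u (nbrs E (zs ! i) \<inter> T - ?K))"
  proof (cases "finite (nbrs E (zs ! i) \<inter> T - ?K)")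
    case True
    then show ?thesis by (intro card_mono) auto
  next
    case False
    \<comment> \<open>No finiteness is assumed here, and an infinite set has cardinality 0, so
      infinity has to be passed on to the larger set.\<close>
    then have "infinite (nbrs E (zs ! i) \<inter> insert u T - ?K)"
      by (meson Diff_mono Int_mono finite_subset order_refl subset_insertI)
    then show ?thesis by simp
  qed
  also have "\<dots> \<le> Suc (card (nbrs E (zs ! i) \<inter> T - ?K))"
    by (cases "finite (nbrs E (zs ! i) \<inter> T - ?K)") (simp_all add: card_insert_if)
  finally show ?thesis using assms by (simp add: guarded_def)
qed

text \<open>The reason why most touches cost nothing: a touch that is an earlier protected vertex,
  or also touches one, is left out of the count that \<open>guarded\<close> makes at
  \<open>zs ! m\<close>.\<close>

lemma in_overlap_take:
  assumes "j < m" "m < length zs" "distinct zs" "x \<in> nbrs E (zs ! m)"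
    and "x = zs ! j \<or> x \<in> nbrs E (zs ! j)"
  shows "x \<in> overlap E (zs ! m) (set (take m zs))"
proof -
  have "zs ! j \<in> set (take m zs)" using assms by (auto simp: in_set_conv_nth)
  moreover have "zs ! j \<noteq> zs ! m" using assms by (simp add: nth_eq_iff_index_eq)
  ultimately show ?thesis using assms by (auto simp: overlap_def)
qed

text \<open>The activation strategy: a touched vertex that is not yet active is activated and passes the
  threat on to its neighbor of highest priority, if that one has a higher priority than itself.
  Hence every vertex is passed at most once before it is colored.\<close>

lemma activation_chain:
  assumes "distinct zs" "i < length zs" "zs ! i \<in> U" "act \<subseteq> T" "act \<subseteq> set zs"
    and "\<And>m. m < length zs \<Longrightarrow> zs ! m \<in> U \<Longrightarrow> guarded E b zs act T (if m = i then 1 else 0) m"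
  shows "\<exists>act' a. act \<subseteq> act' \<and> act' \<subseteq> set zs \<and> a \<in> set zs \<inter> U \<and>
    (\<forall>m<length zs. zs ! m \<in> U - {a} \<longrightarrow> guarded E b zs act' (insert a (T \<union> act')) 0 m)"
  using assms(2-6)
proof (induction i arbitrary: act T rule: less_induct)
  case (less i)
  let ?z = "zs ! i"
  have zs: "?z \<in> set zs" using less.prems by simp
  show ?case
  proof (cases "?z \<in> act")
    case True
    \<comment> \<open>An active vertex entered \<open>T\<close> when it was activated, so coloring
      it now is not a new touch for anyone.\<close>
    have "insert ?z (T \<union> act) = T" using True less.prems(3) by auto
    moreover have "guarded E b zs act T 0 m" if "m < length zs" "zs ! m \<in> U - {?z}" for m
      using less.prems(5)[of m] that by (auto split: if_splits)
    ultimately show ?thesis using less.prems zs by (intro exI[of _ act] exI[of _ ?z]) auto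
  next
    case z: False
    show ?thesis
    proof (cases "\<exists>j<i. zs ! j \<in> U \<inter> nbrs E ?z")
      case False
      have "guarded E b zs act (insert ?z (T \<union> act)) 0 m" if m: "m < length zs" "zs ! m \<in> U - {?z}" for m
      proof -
        have "T \<union> act = T" using less.prems by auto
        moreover have "guarded E b zs act T 0 m" using less.prems(5)[of m] m by (auto split: if_splits)
        \<comment> \<open>The uncolored neighbors that remain have lower priority, and for them
          \<open>?z\<close> is itself an earlier vertex.\<close>
        moreover have "?z \<in> overlap E (zs ! m) (set (take m zs))" if "?z \<in> nbrs E (zs ! m)"
        proof -
          have "m \<noteq> i" using m by auto
          moreover have "\<not> m < i" using False m nbrs_sym[OF that] by auto
          ultimately show ?thesis using that m assms(1) by (intro in_overlap_take[of i]) auto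
        qed
        ultimately show ?thesis by (simp add: guarded_insert_overlap)
      qed
      then show ?thesis using less.prems zs by (intro exI[of _ act] exI[of _ ?z]) auto
    next
      case True
      define j where "j = (LEAST j. j < i \<and> zs ! j \<in> U \<inter> nbrs E ?z)"
      have j: "j < i" "zs ! j \<in> U" "zs ! j \<in> nbrs E ?z"
        using LeastI_ex[of "\<lambda>j. j < i \<and> zs ! j \<in> U \<inter> nbrs E ?z"] True by (auto simp: j_def)
      have jmin: "j \<le> m" if "m < i" "zs ! m \<in> U" "zs ! m \<in> nbrs E ?z" for m
        unfolding j_def using that by (intro Least_le) auto
      \<comment> \<open>\<open>?z\<close> enters \<open>T\<close> without being colored: its later
        touch is charged in advance, and to \<open>zs ! j\<close> alone.\<close>
      let ?act = "insert ?z act" and ?T = "insert ?z T"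
      have step: "guarded E b zs ?act ?T (if m = j then 1 else 0) m"
        if m: "m < length zs" "zs ! m \<in> U" for m
      proof (cases "m = i")
        case True
        have "guarded E b zs act ?T 1 i"
          using guarded_insert_overlap[OF less.prems(5)[OF m], of ?z] True by simp
        \<comment> \<open>Activation raises the allowance of \<open>?z\<close> by one, which absorbs
          the extra touch that it has just received.\<close>
        then show ?thesis using z True j(1) by (simp add: guarded_def)
      next
        case False
        then have ne: "zs ! m \<noteq> ?z" using assms(1) m less.prems(1) by (simp add: nth_eq_iff_index_eq)
        have g0: "guarded E b zs act T 0 m" using less.prems(5)[OF m] False by simp
        have "guarded E b zs act ?T (if m = j then 1 else 0) m"
        proof (cases "m = j")
          case True
          then show ?thesis using guarded_insert[OF g0] by simp
        next
          case mj: False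
          have "?z \<in> overlap E (zs ! m) (set (take m zs))" if nb: "?z \<in> nbrs E (zs ! m)"
          proof (cases "m < i")
            case True
            \<comment> \<open>By minimality of \<open>j\<close> such an \<open>m\<close> comes after
              \<open>j\<close>, and \<open>?z\<close> is adjacent to both.\<close>
            then have "j < m" using jmin[OF True m(2)] nbrs_sym[OF nb] mj by auto
            then show ?thesis using in_overlap_take[OF _ m(1) assms(1) nb, of j] nbrs_sym[OF j(3)] by simp
          next
            case False
            then show ?thesis using in_overlap_take[OF _ m(1) assms(1) nb, of i] \<open>m \<noteq> i\<close> by simp
          qed
          then show ?thesis using guarded_insert_overlap[OF g0] mj by simp
        qed
        then show ?thesis using ne by (simp add: guarded_def)
      qed
      have "j < length zs" "?act \<subseteq> ?T" "?act \<subseteq> set zs" using j less.prems zs by auto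
      from less.IH[OF j(1) this(1) j(2) this(2,3) step]
      obtain act' a where a: "?act \<subseteq> act'" "act' \<subseteq> set zs" "a \<in> set zs \<inter> U"
        "\<forall>m<length zs. zs ! m \<in> U - {a} \<longrightarrow> guarded E b zs act' (insert a (?T \<union> act')) 0 m"
        by auto
      have "?T \<union> act' = T \<union> act'" using a(1) by auto
      then show ?thesis using a by (intro exI[of _ act'] exI[of _ a]) auto
    qed
  qed
qed

text \<open>B's move \<open>u\<close> is charged only to its uncolored protected neighbor of highest
  priority; every other one shares \<open>u\<close> with that vertex, so \<open>u\<close> lies in
  its overlap. If \<open>u\<close> has no such neighbor, A colors the first uncolored vertex of the
  list, which precedes all remaining ones and hence is charged to none.\<close>

lemma activation_response:
  assumes "distinct zs" "act \<subseteq> T" "act \<subseteq> set zs" "set zs \<inter> U \<noteq> {}"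
    and g: "\<And>m. m < length zs \<Longrightarrow> zs ! m \<in> U \<Longrightarrow> guarded E b zs act T 0 m"
  shows "\<exists>act' a. act \<subseteq> act' \<and> act' \<subseteq> set zs \<and> a \<in> set zs \<inter> U \<and>
    (\<forall>m<length zs. zs ! m \<in> U - {a} \<longrightarrow> guarded E b zs act' (insert a (insert u T \<union> act')) 0 m)"
proof (cases "\<exists>j<length zs. zs ! j \<in> U \<inter> nbrs E u")
  case True
  define j where "j = (LEAST j. j < length zs \<and> zs ! j \<in> U \<inter> nbrs E u)"
  have j: "j < length zs" "zs ! j \<in> U" "zs ! j \<in> nbrs E u"
    using LeastI_ex[of "\<lambda>j. j < length zs \<and> zs ! j \<in> U \<inter> nbrs E u"] True by (auto simp: j_def)
  have jmin: "j \<le> m" if "m < length zs" "zs ! m \<in> U" "zs ! m \<in> nbrs E u" for m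
    unfolding j_def using that by (intro Least_le) auto
  have "guarded E b zs act (insert u T) (if m = j then 1 else 0) m"
    if m: "m < length zs" "zs ! m \<in> U" for m
  proof (cases "m = j")
    case True
    then show ?thesis using guarded_insert[OF g[OF m]] by simp
  next
    case False
    have "u \<in> overlap E (zs ! m) (set (take m zs))" if nb: "u \<in> nbrs E (zs ! m)"
    proof -
      have "j < m" using jmin[OF m nbrs_sym[OF nb]] False by auto
      then show ?thesis using in_overlap_take[OF _ m(1) assms(1) nb, of j] nbrs_sym[OF j(3)] by simp
    qed
    then show ?thesis using guarded_insert_overlap[OF g[OF m]] False by simp
  qed
  from activation_chain[OF assms(1) j(1,2) _ assms(3) this] assms(2) show ?thesis by blast
next
  case False
  define i where "i = (LEAST i. i < length zs \<and> zs ! i \<in> U)"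
  have "\<exists>i. i < length zs \<and> zs ! i \<in> U" using assms(4) by (auto simp: in_set_conv_nth)
  then have i: "i < length zs" "zs ! i \<in> U"
    using LeastI_ex[of "\<lambda>i. i < length zs \<and> zs ! i \<in> U"] by (auto simp: i_def)
  have imin: "i \<le> m" if "m < length zs" "zs ! m \<in> U" for m
    unfolding i_def using that by (intro Least_le) auto
  have "guarded E b zs act (insert (zs ! i) (insert u T \<union> act)) 0 m"
    if m: "m < length zs" "zs ! m \<in> U - {zs ! i}" for m
  proof -
    have "u \<notin> nbrs E (zs ! m)" using False m nbrs_sym[of u E "zs ! m"] by auto
    then have "guarded E b zs act (insert u T) 0 m" using g m by (intro guarded_insert_overlap) auto
    moreover have "insert u T \<union> act = insert u T" using assms(2) by auto
    moreover have "zs ! i \<in> overlap E (zs ! m) (set (take m zs))" if "zs ! i \<in> nbrs E (zs ! m)"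
    proof -
      have "i < m" using imin[of m] m by (cases "m = i") auto
      then show ?thesis using that m assms(1) by (intro in_overlap_take[of i]) auto
    qed
    ultimately show ?thesis by (simp add: guarded_insert_overlap)
  qed
  then show ?thesis using i assms(3) by (intro exI[of _ act] exI[of _ "zs ! i"]) auto
qed

section \<open>Winning on sparse hypergraphs\<close>

text \<open>The invariant \<open>Q\<close> describes positions after a move of A; at A's turns the
  induction carries instead that some move restores it. Since A picks such a move by choice from the
  history alone, all bookkeeping may be existentially quantified inside \<open>Q\<close>.\<close>

lemma winning_strategy_A_invariant:
  assumes start: "\<not> B_has_won V E q []"
      "\<not> all_colored V [] \<Longrightarrow> \<exists>m. legal_move V E q [] m \<and> Q [m]"
    and safe: "\<And>ms. Q ms \<Longrightarrow> \<not> B_has_won V E q ms"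
    and step: "\<And>ms m. Q ms \<Longrightarrow> legal_move V E q ms m \<Longrightarrow> \<not> B_has_won V E q (m # ms) \<and>
      (all_colored V (m # ms) \<or> (\<exists>m'. legal_move V E q (m # ms) m' \<and> Q (m' # m # ms)))"
  shows "\<exists>\<sigma>. winning_strategy_A V E q \<sigma>"
proof -
  define \<sigma> where "\<sigma> ms = (SOME m. legal_move V E q ms m \<and> Q (m # ms))" for ms
  have \<sigma>: "legal_move V E q ms (\<sigma> ms) \<and> Q (\<sigma> ms # ms)"
    if "\<exists>m. legal_move V E q ms m \<and> Q (m # ms)" for ms
    unfolding \<sigma>_def using that by (rule someI_ex)
  have inv: "(odd (length ms) \<longrightarrow> Q ms) \<and> (even (length ms) \<longrightarrow> \<not> B_has_won V E q ms \<and>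
      (all_colored V ms \<or> (\<exists>m. legal_move V E q ms m \<and> Q (m # ms))))"
    if "consistent_history V E q \<sigma> ms" for ms
    using that
  proof induction
    case start
    then show ?case using assms(1,2) by auto
  next
    case (move_A ms)
    then have "\<not> all_colored V ms" by (auto simp: legal_move_def all_colored_def)
    then show ?case using move_A \<sigma>[of ms] by auto
  next
    case (move_B ms m)
    then show ?case using step[of ms m] by auto
  qed
  have "winning_strategy_A V E q \<sigma>"
    unfolding winning_strategy_A_def
  proof (intro allI impI conjI)
    fix ms assume c: "consistent_history V E q \<sigma> ms"
    show "\<not> B_has_won V E q ms" using inv[OF c] safe by (cases "even (length ms)") auto
    assume "even (length ms) \<and> \<not> all_colored V ms"
    then show "legal_move V E q ms (\<sigma> ms)" using inv[OF c] \<sigma> by auto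
  qed
  then show ?thesis by blast
qed

text \<open>In \<open>2 * (L + m\<^sub>1) + 2\<close>, A's moves after the opening hit protected or
  endangered vertices, B's moves double their number, and 2 stands for the opening and B's latest
  move. The factor 2 in \<open>few_overlaps\<close> keeps the vertices of overlap at least
  \<open>g\<close> below half of any small set. The constant in \<open>q_large\<close> leaves room
  for the touches caused by activation and for B's next move.\<close>

locale guarded_game =
  fixes V :: "'a set" and E :: "'a set set" and q a g\<^sub>0 g L m\<^sub>1 m\<^sub>2 :: nat
  assumes finite_V: "finite V"
    and edge: "\<And>e. e \<in> E \<Longrightarrow> e \<subseteq> V \<and> 2 \<le> card e"
    and few_endangered: "\<And>c. card {v \<in> V. a \<le> card (blocked E q c v)} \<le> m\<^sub>1"
    and few_attacked: "\<And>W. W \<subseteq> V \<Longrightarrow> card W \<le> 2 * (L + m\<^sub>1) + 2 \<Longrightarrow>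
      card {v \<in> V. g\<^sub>0 \<le> card (nbrs E v \<inter> W)} \<le> m\<^sub>2"
    and few_overlaps: "\<And>S. S \<subseteq> V \<Longrightarrow> S \<noteq> {} \<Longrightarrow> card S \<le> L \<Longrightarrow>
      2 * (\<Sum>v\<in>S. card (overlap E v S)) < g * card S"
    and m2_le: "2 * m\<^sub>2 \<le> L"
    and q_large: "a + g\<^sub>0 + 2 * g + 3 < q"
    and pos: "0 < a" "0 < g" "0 < g\<^sub>0"
begin

lemma nbrs_subset: "nbrs E v \<subseteq> V"
  using edge by (auto simp: nbrs_def)

lemma finite_nbrs [simp]: "finite (nbrs E v)"
  using nbrs_subset finite_V finite_subset by blast

lemma finite_overlap [simp]: "finite (overlap E v S)"
  by (rule finite_subset[OF _ finite_nbrs[of v]]) (auto simp: overlap_def)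

lemma card_overlap_mono: "S \<subseteq> T \<Longrightarrow> card (overlap E v S) \<le> card (overlap E v T)"
  by (intro card_mono overlap_mono) auto

lemma legal_if_not_blocked:
  assumes "proper_partial_coloring E (map_of ms)" "v \<in> V - dom (map_of ms)"
    and "k \<in> {1..q} - blocked E q (map_of ms) v"
  shows "legal_move V E q ms (v, k)"
proof -
  have "\<not> (\<forall>x\<in>e. ((map_of ms)(v \<mapsto> k)) x = Some j)" if e: "e \<in> E" for e j
  proof
    assume *: "\<forall>x\<in>e. ((map_of ms)(v \<mapsto> k)) x = Some j"
    show False
    proof (cases "v \<in> e")
      case True
      have "j = k" using bspec[OF * True] by simp
      then have "\<forall>x\<in>e - {v}. map_of ms x = Some k"
        using * by (metis DiffE fun_upd_other insertCI)
      then have "k \<in> blocked E q (map_of ms) v" using True e assms(3) by (auto simp: blocked_def)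
      then show False using assms(3) by simp
    next
      case False
      then have "\<forall>x\<in>e. map_of ms x = Some j" using * by (metis fun_upd_other)
      then show False using assms(1) e by (auto simp: proper_partial_coloring_def)
    qed
  qed
  then show ?thesis using assms(2,3)
    by (auto simp: legal_move_def proper_partial_coloring_def)
qed

lemma exists_legal_move:
  assumes "proper_partial_coloring E (map_of ms)" "v \<in> V - dom (map_of ms)"
    and "card (blocked E q (map_of ms) v) < q"
  shows "\<exists>k. legal_move V E q ms (v, k)"
proof -
  have "{1..q} - blocked E q (map_of ms) v \<noteq> {}"
  proof
    assume "{1..q} - blocked E q (map_of ms) v = {}"
    then have "card {1..q} \<le> card (blocked E q (map_of ms) v)" by (intro card_mono) auto
    then show False using assms(3) by simp
  qed
  then show ?thesis using legal_if_not_blocked[OF assms(1,2)] by blast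
qed

text \<open>A certificate that bounds the size of the protected set. Overlaps are taken with all of
  \<open>Z\<close> and not only with the vertices inserted before \<open>z\<close>, so the order of
  insertion is forgotten and the certificate survives the growth of \<open>W\<close>.\<close>

definition justified :: "'a set \<Rightarrow> 'a set \<Rightarrow> bool" where
  "justified W Z \<longleftrightarrow> (\<forall>z\<in>Z. g\<^sub>0 \<le> card (nbrs E z \<inter> W) \<or> g \<le> card (overlap E z Z))"

definition ranked :: "'a list \<Rightarrow> bool" where
  "ranked zs \<longleftrightarrow> distinct zs \<and> (\<forall>i<length zs. card (overlap E (zs ! i) (set (take i zs))) < 2 * g)"

lemma justified_mono:
  assumes "justified W Z" "W \<subseteq> W'"
  shows "justified W' Z"
proof -
  have "card (nbrs E z \<inter> W) \<le> card (nbrs E z \<inter> W')" for z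
    using assms(2) by (intro card_mono) auto
  then show ?thesis using assms(1) by (meson justified_def le_trans)
qed

text \<open>At most \<open>m\<^sub>2\<close> vertices are attacked, and fewer than half can be
  justified by overlaps alone because the average overlap is below \<open>g / 2\<close>. The bound
  improves on the assumed cap \<open>L\<close>, and this gap is what lets the protected set be
  closed.\<close>

lemma card_justified:
  assumes "justified W Y" "Y \<subseteq> V" "card Y \<le> L" "W \<subseteq> V" "card W \<le> 2 * (L + m\<^sub>1) + 2"
  shows "card Y < 2 * m\<^sub>2 \<or> Y = {}"
proof (cases "Y = {}")
  case False
  define A where "A = {v \<in> V. g\<^sub>0 \<le> card (nbrs E v \<inter> W)}"
  have fin: "finite Y" "finite A" using assms(2) finite_V finite_subset by (auto simp: A_def)
  have "2 * (g * card (Y - A)) \<le> 2 * (\<Sum>v\<in>Y - A. card (overlap E v Y))"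
  proof -
    have "g \<le> card (overlap E v Y)" if "v \<in> Y - A" for v
      using that assms(1,2) unfolding justified_def A_def by blast
    then have "of_nat (card (Y - A)) * g \<le> (\<Sum>v\<in>Y - A. card (overlap E v Y))"
      by (intro sum_bounded_below)
    then show ?thesis by (simp add: mult.commute)
  qed
  also have "\<dots> \<le> 2 * (\<Sum>v\<in>Y. card (overlap E v Y))"
    using fin by (intro mult_left_mono sum_mono2) auto
  also have "\<dots> < g * card Y" using few_overlaps assms(2,3) False by blast
  finally have "g * (2 * card (Y - A)) < g * card Y" by (simp add: mult.left_commute)
  then have "2 * card (Y - A) < card Y" by simp
  moreover have "card Y \<le> card (Y - A) + card A"
    using fin by (metis card_Un_le card_mono finite_Diff finite_UnI Un_Diff_cancel2 Un_upper1 le_trans)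
  moreover have "card A \<le> m\<^sub>2" unfolding A_def using few_attacked assms(4,5) by blast
  ultimately show ?thesis by simp
qed simp

text \<open>A largest justified set below the cap is closed: adding an offending vertex keeps it
  justified, and the gap between \<open>2 * m\<^sub>2\<close> and the actual size keeps it below the
  cap. Only the new vertices are put in a degeneracy order; their overlap with the old list is below
  \<open>g\<close> by closedness and with their new predecessors by degeneracy, whence
  \<open>2 * g\<close>.\<close>

lemma exists_closed_extension:
  assumes Z: "set zs \<subseteq> V" "ranked zs" "card (set zs) \<le> L" "justified W (set zs)"
    and closed: "\<And>v. v \<in> V - set zs \<Longrightarrow> card (overlap E v (set zs)) < g"
    and W: "W \<subseteq> V" "card W \<le> 2 * (L + m\<^sub>1) + 2"
  shows "\<exists>ys. set (zs @ ys) \<subseteq> V \<and> ranked (zs @ ys) \<and> card (set (zs @ ys)) \<le> L \<and>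
    justified W (set (zs @ ys)) \<and>
    (\<forall>v\<in>V - set (zs @ ys). card (overlap E v (set (zs @ ys))) < g \<and> card (nbrs E v \<inter> W) < g\<^sub>0)"
proof -
  let ?P = "\<lambda>Y. set zs \<subseteq> Y \<and> Y \<subseteq> V \<and> card Y \<le> L \<and> justified W Y"
  define Y where "Y = arg_max card ?P"
  have "\<forall>Y. ?P Y \<longrightarrow> card Y < Suc L" by auto
  moreover have "?P (set zs)" using Z by auto
  ultimately have Y: "?P Y" and max: "\<And>Y'. ?P Y' \<Longrightarrow> card Y' \<le> card Y"
    using arg_max_nat_lemma[of ?P "set zs" card "Suc L"] unfolding Y_def by blast+
  have finY: "finite Y" using Y finite_V finite_subset by blast
  have cl: "card (overlap E v Y) < g \<and> card (nbrs E v \<inter> W) < g\<^sub>0" if v: "v \<in> V - Y" for v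
  proof (rule ccontr)
    assume *: "\<not> ?thesis"
    have "justified W (insert v Y)"
      unfolding justified_def
    proof
      fix z assume "z \<in> insert v Y"
      moreover have "card (overlap E z Y) \<le> card (overlap E z (insert v Y))"
        by (intro card_overlap_mono) auto
      ultimately show "g\<^sub>0 \<le> card (nbrs E z \<inter> W) \<or> g \<le> card (overlap E z (insert v Y))"
        using * Y unfolding justified_def by (metis insertE le_trans not_less)
    qed
    moreover have "card (insert v Y) \<le> L"
    proof (cases "Y = {}")
      \<comment> \<open>For the empty set the strict bound by \<open>2 * m\<^sub>2\<close> may fail.
        But nothing overlaps with it, so \<open>v\<close> must be attacked and
        \<open>m\<^sub>2\<close> is positive.\<close>
      case True
      then have "g\<^sub>0 \<le> card (nbrs E v \<inter> W)" using * pos by auto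
      then have "v \<in> {v \<in> V. g\<^sub>0 \<le> card (nbrs E v \<inter> W)}" using v by simp
      then have "1 \<le> card {v \<in> V. g\<^sub>0 \<le> card (nbrs E v \<inter> W)}"
        using finite_V card_gt_0_iff[of "{v \<in> V. g\<^sub>0 \<le> card (nbrs E v \<inter> W)}"] by auto
      then have "1 \<le> m\<^sub>2" using few_attacked[OF W] by simp
      then show ?thesis using True m2_le by simp
    next
      case False
      then have "card Y < 2 * m\<^sub>2" using card_justified[of W Y] Y W by blast
      then show ?thesis using finY m2_le by (simp add: card_insert_if)
    qed
    ultimately have "card (insert v Y) \<le> card Y" using Y v by (intro max) auto
    then show False using v finY by simp
  qed
  have "\<exists>v\<in>S. card (overlap E v S) < g" if S: "S \<subseteq> Y - set zs" "S \<noteq> {}" for S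
  proof (rule ccontr)
    assume "\<not> ?thesis"
    then have "of_nat (card S) * g \<le> (\<Sum>v\<in>S. card (overlap E v S))"
      by (intro sum_bounded_below) (auto simp: not_less)
    moreover have "S \<subseteq> Y" using S by auto
    then have "card S \<le> L" using card_mono[OF finY, of S] Y by linarith
    then have "2 * (\<Sum>v\<in>S. card (overlap E v S)) < g * card S"
      using S Y by (intro few_overlaps) auto
    ultimately show False by (simp add: mult.commute)
  qed
  then obtain ys where ys: "distinct ys" "set ys = Y - set zs"
    "\<forall>i<length ys. card (overlap E (ys ! i) (set (take i ys))) < g"
    using exists_degenerate_list[of "Y - set zs" E g] finY by (metis finite_Diff)
  have Yeq: "set (zs @ ys) = Y" using ys(2) Y by auto
  have "card (overlap E ((zs @ ys) ! i) (set (take i (zs @ ys)))) < 2 * g"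
    if i: "i < length (zs @ ys)" for i
  proof (cases "i < length zs")
    case True
    then show ?thesis using Z(2) by (simp add: ranked_def nth_append)
  next
    case False
    define j where "j = i - length zs"
    have j: "i = length zs + j" "j < length ys" using False i by (auto simp: j_def)
    have "ys ! j \<in> V - set zs" using ys(2) Y j nth_mem[of j ys] by blast
    then have "card (overlap E (ys ! j) (set zs)) < g" by (rule closed)
    moreover have "card (overlap E (ys ! j) (set (take j ys))) < g" using ys j by blast
    ultimately have "card (overlap E (ys ! j) (set zs \<union> set (take j ys))) < 2 * g"
      unfolding overlap_Un
      using card_Un_le[of "overlap E (ys ! j) (set zs)" "overlap E (ys ! j) (set (take j ys))"]
      by linarith
    then show ?thesis using j by (simp add: nth_append)
  qed
  then have "ranked (zs @ ys)" using Z(2) ys by (auto simp: ranked_def)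
  then show ?thesis using Yeq Y cl by metis
qed

text \<open>Invariant after a move of A: \<open>W\<close> are the vertices colored in the current stage, that is, since
  the last time that no uncolored vertex had \<open>a\<close> blocked colors on a turn of A; \<open>WA\<close> are those of
  them that A colored after the opening move of the stage, \<open>zs\<close> the protected vertices in order of
  decreasing priority, and \<open>act\<close> the activated ones.\<close>

definition stage ::
  "('a \<rightharpoonup> nat) \<Rightarrow> 'a set \<Rightarrow> 'a set \<Rightarrow> 'a list \<Rightarrow> 'a set \<Rightarrow> bool" where
  "stage c W WA zs act \<longleftrightarrow>
     W \<subseteq> dom c \<and> dom c \<subseteq> V \<and> WA \<subseteq> W \<and> WA \<subseteq> set zs \<union> {v \<in> V. a \<le> card (blocked E q c v)} \<and>
     card W \<le> 2 * card WA + 1 \<and>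
     (\<forall>v\<in>V - dom c. card (blocked E q c v) \<le> a + card (nbrs E v \<inter> W)) \<and>
     set zs \<subseteq> V \<and> ranked zs \<and> card (set zs) \<le> L \<and> justified W (set zs) \<and>
     (\<forall>v\<in>V - set zs. card (overlap E v (set zs)) < g \<and> card (nbrs E v \<inter> W) \<le> g\<^sub>0) \<and>
     act \<subseteq> set zs \<and>
     (\<forall>i<length zs. zs ! i \<notin> dom c \<longrightarrow> guarded E (g\<^sub>0 + 1) zs act (W \<union> act) 0 i)"

text \<open>The margin is 2 and not 1: B's next move may block one more color, and a free one must
  still be left.\<close>

lemma stage_blocked:
  assumes "stage c W WA zs act" "v \<in> V - dom c"
  shows "card (blocked E q c v) + 2 \<le> q"
proof -
  have "card (nbrs E v \<inter> W) \<le> g\<^sub>0 + 2 * g + 1"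
  proof (cases "v \<in> set zs")
    case True
    then obtain i where i: "i < length zs" "v = zs ! i" by (auto simp: in_set_conv_nth)
    let ?K = "overlap E v (set (take i zs))"
    have "guarded E (g\<^sub>0 + 1) zs act (W \<union> act) 0 i" using assms i by (simp add: stage_def)
    then have "card (nbrs E v \<inter> (W \<union> act) - ?K) \<le> g\<^sub>0 + 2"
      using i by (simp add: guarded_def split: if_splits)
    moreover have "card ?K < 2 * g" using assms i by (simp add: stage_def ranked_def)
    moreover have "card (nbrs E v \<inter> W) \<le> card ((nbrs E v \<inter> (W \<union> act) - ?K) \<union> ?K)"
      by (intro card_mono) auto
    moreover have "\<dots> \<le> card (nbrs E v \<inter> (W \<union> act) - ?K) + card ?K" by (rule card_Un_le)
    ultimately show ?thesis by linarith
  next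
    case False
    then have "card (nbrs E v \<inter> W) \<le> g\<^sub>0" using assms by (simp add: stage_def)
    then show ?thesis by simp
  qed
  moreover have "card (blocked E q c v) \<le> a + card (nbrs E v \<inter> W)"
    using assms by (simp add: stage_def)
  ultimately show ?thesis using q_large by linarith
qed

text \<open>The opening move belongs to \<open>W\<close> but not to \<open>WA\<close>, since it need
  be neither protected nor endangered; it is the 1 in
  \<open>card W \<le> 2 * card WA + 1\<close>.\<close>

lemma stage_reset:
  assumes "dom c \<subseteq> V" "v \<in> V - dom c" "\<And>w. w \<in> V - dom c \<Longrightarrow> card (blocked E q c w) < a"
  shows "stage (c(v \<mapsto> k)) {v} {} [] {}"
proof -
  have "card (blocked E q (c(v \<mapsto> k)) w) \<le> a + card (nbrs E w \<inter> {v})"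
    if "w \<in> V - dom (c(v \<mapsto> k))" for w
    using card_blocked_update[of E q c v k w] assms(3)[of w] that by (auto split: if_splits)
  moreover have "card (nbrs E w \<inter> {v}) \<le> g\<^sub>0" for w
    using card_mono[of "{v}" "nbrs E w \<inter> {v}"] pos by simp
  ultimately show ?thesis using assms pos
    by (auto simp: stage_def ranked_def justified_def)
qed

text \<open>The color \<open>j\<close> is arbitrary because the invariant only counts touches. A's
  real decision is the vertex, and any legal color for it will do.\<close>

lemma stage_step:
  assumes st: "stage c W WA zs act" and u: "u \<in> V - dom c"
    and danger: "\<exists>w\<in>V - dom (c(u \<mapsto> k)). a \<le> card (blocked E q (c(u \<mapsto> k)) w)"
  shows "\<exists>w\<in>V - dom (c(u \<mapsto> k)). \<forall>j. \<exists>W WA zs act. stage (c(u \<mapsto> k, w \<mapsto> j)) W WA zs act"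
proof -
  define c' where "c' = c(u \<mapsto> k)"
  define W' where "W' = insert u W"
  define D where "D = {v \<in> V. a \<le> card (blocked E q c' v)}"
  have st': "W \<subseteq> dom c" "dom c \<subseteq> V" "WA \<subseteq> W"
    "WA \<subseteq> set zs \<union> {v \<in> V. a \<le> card (blocked E q c v)}" "card W \<le> 2 * card WA + 1"
    "\<And>v. v \<in> V - dom c \<Longrightarrow> card (blocked E q c v) \<le> a + card (nbrs E v \<inter> W)"
    "set zs \<subseteq> V" "ranked zs" "card (set zs) \<le> L" "justified W (set zs)" "act \<subseteq> set zs"
    and closed: "\<And>v. v \<in> V - set zs \<Longrightarrow> card (overlap E v (set zs)) < g"
      "\<And>v. v \<in> V - set zs \<Longrightarrow> card (nbrs E v \<inter> W) \<le> g\<^sub>0"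
    and guard: "\<And>i. i < length zs \<Longrightarrow> zs ! i \<notin> dom c \<Longrightarrow> guarded E (g\<^sub>0 + 1) zs act (W \<union> act) 0 i"
    using st unfolding stage_def by blast+
  have finV: "finite X" if "X \<subseteq> V" for X using that finite_V finite_subset by blast
  have fin: "finite W" "finite WA" "finite (set zs)" using st'(1-3,7) by (auto intro!: finV)
  have le: "c \<subseteq>\<^sub>m c'" using u by (auto simp: c'_def map_le_def)
  have card_bl: "card (blocked E q c v) \<le> card (blocked E q c' v)" for v
    using blocked_mono[OF le] by (intro card_mono) auto
  \<comment> \<open>Blocked colors never become free, so all endangered vertices that A colored in
    this stage are endangered in the present coloring, and one application of
    \<open>few_endangered\<close> counts them.\<close>
  have WA: "WA \<subseteq> set zs \<union> D" using st'(4) le_trans[OF _ card_bl] by (auto simp: D_def)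
  have "card WA \<le> card (set zs \<union> D)" using WA finite_V by (intro card_mono) (auto simp: D_def)
  also have "\<dots> \<le> card (set zs) + card D" by (rule card_Un_le)
  also have "\<dots> \<le> L + m\<^sub>1" using st'(9) few_endangered[of c'] by (simp add: D_def)
  finally have "card W' \<le> 2 * (L + m\<^sub>1) + 2"
    using st'(5) fin by (simp add: W'_def card_insert_if)
  moreover have "W' \<subseteq> V" using st'(1,2) u by (auto simp: W'_def)
  moreover have "justified W' (set zs)" using st'(10) by (rule justified_mono) (auto simp: W'_def)
  ultimately obtain ys where ys: "set (zs @ ys) \<subseteq> V" "ranked (zs @ ys)" "card (set (zs @ ys)) \<le> L"
      "justified W' (set (zs @ ys))"
      "\<forall>v\<in>V - set (zs @ ys). card (overlap E v (set (zs @ ys))) < g \<and> card (nbrs E v \<inter> W') < g\<^sub>0"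
    using exists_closed_extension[OF st'(7-9) _ closed(1), of W'] by blast
  define xs where "xs = zs @ ys"
  define U where "U = V - dom c'"
  have dist: "distinct xs" using ys(2) by (simp add: ranked_def xs_def)
  have act: "act \<subseteq> set xs" using st'(11) by (auto simp: xs_def)
  have gd: "guarded E (g\<^sub>0 + 1) xs act (W \<union> act) 0 i" if i: "i < length xs" "xs ! i \<in> U" for i
  proof (cases "i < length zs")
    case True
    then have "xs ! i = zs ! i" "take i xs = take i zs" by (auto simp: xs_def nth_append)
    moreover have "zs ! i \<notin> dom c" using i \<open>xs ! i = zs ! i\<close> by (auto simp: U_def c'_def)
    ultimately show ?thesis using guard[OF True] by (simp add: guarded_def)
  next
    case False
    \<comment> \<open>For a newly protected vertex, active vertices are older and thus fall into the
      overlap. Of the moves before B's latest one it has at most \<open>g\<^sub>0\<close> neighbors,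
      because it was still unprotected; B's latest move is left to
      \<open>activation_response\<close>.\<close>
    then have "set zs \<subseteq> set (take i xs)" by (auto simp: xs_def)
    moreover have new: "xs ! i \<notin> set zs"
    proof -
      have "xs ! i \<in> set ys" using False i by (auto simp: xs_def nth_append)
      then show ?thesis using dist by (auto simp: xs_def)
    qed
    ultimately have "nbrs E (xs ! i) \<inter> act \<subseteq> overlap E (xs ! i) (set (take i xs))"
      using st'(11) by (auto simp: overlap_def)
    then have "nbrs E (xs ! i) \<inter> (W \<union> act) - overlap E (xs ! i) (set (take i xs)) \<subseteq> nbrs E (xs ! i) \<inter> W"
      by auto
    then have "card (nbrs E (xs ! i) \<inter> (W \<union> act) - overlap E (xs ! i) (set (take i xs)))
        \<le> card (nbrs E (xs ! i) \<inter> W)"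
      by (intro card_mono) auto
    also have "\<dots> \<le> g\<^sub>0" using closed(2) new i by (simp add: U_def)
    finally show ?thesis by (simp add: guarded_def)
  qed
  have "\<exists>act' w. act' \<subseteq> set xs \<and> w \<in> U \<and> w \<in> set xs \<union> D \<and>
      (\<forall>i<length xs. xs ! i \<in> U - {w} \<longrightarrow> guarded E (g\<^sub>0 + 1) xs act' (insert w W' \<union> act') 0 i)"
  proof (cases "set xs \<inter> U = {}")
    case True
    \<comment> \<open>With all protected vertices colored, A spends the move on an endangered
      vertex, so that it is still covered by the bound on the stage length.\<close>
    from danger obtain w where "w \<in> U" "w \<in> D" by (auto simp: U_def D_def c'_def)
    moreover have "xs ! i \<notin> U" if "i < length xs" for i using True nth_mem[OF that] by blast
    ultimately show ?thesis by (intro exI[of _ "{}"] exI[of _ w]) auto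
  next
    case False
    from activation_response[OF dist _ act False gd, of u] obtain act' w where
      w: "act \<subseteq> act'" "act' \<subseteq> set xs" "w \<in> set xs \<inter> U"
      "\<forall>i<length xs. xs ! i \<in> U - {w} \<longrightarrow>
        guarded E (g\<^sub>0 + 1) xs act' (insert w (insert u (W \<union> act) \<union> act')) 0 i"
      by auto
    moreover have "insert w (insert u (W \<union> act) \<union> act') = insert w W' \<union> act'"
      using w(1) by (auto simp: W'_def)
    ultimately show ?thesis by (intro exI[of _ act'] exI[of _ w]) auto
  qed
  then obtain act' w where w: "act' \<subseteq> set xs" "w \<in> U" "w \<in> set xs \<union> D"
      "\<forall>i<length xs. xs ! i \<in> U - {w} \<longrightarrow> guarded E (g\<^sub>0 + 1) xs act' (insert w W' \<union> act') 0 i"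
    by blast
  have "stage (c'(w \<mapsto> j)) (insert w W') (insert w WA) xs act'" for j
  proof -
    have le': "c' \<subseteq>\<^sub>m c'(w \<mapsto> j)" using w(2) by (auto simp: U_def map_le_def)
    have "card (blocked E q c' v) \<le> card (blocked E q (c'(w \<mapsto> j)) v)" for v
      using blocked_mono[OF le'] by (intro card_mono) auto
    then have D: "D \<subseteq> {v \<in> V. a \<le> card (blocked E q (c'(w \<mapsto> j)) v)}"
      unfolding D_def using le_trans by blast
    have wW: "w \<notin> W'" "w \<notin> WA" using w(2) st'(1,3) by (auto simp: U_def W'_def c'_def)
    have uW: "u \<notin> W" using u st'(1) by auto
    have bl: "card (blocked E q (c'(w \<mapsto> j)) v) \<le> a + card (nbrs E v \<inter> insert w W')"
      if v: "v \<in> V - dom (c'(w \<mapsto> j))" for v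
    proof -
      have "card (blocked E q (c'(w \<mapsto> j)) v) \<le> card (blocked E q c v)
          + (if u \<in> nbrs E v then 1 else 0) + (if w \<in> nbrs E v then 1 else 0)"
        using card_blocked_update[of E q c u k v] card_blocked_update[of E q c' w j v]
        unfolding c'_def by linarith
      also have "card (blocked E q c v) \<le> a + card (nbrs E v \<inter> W)"
        using st'(6) v by (auto simp: c'_def)
      also have "a + card (nbrs E v \<inter> W) + (if u \<in> nbrs E v then 1 else 0)
          + (if w \<in> nbrs E v then 1 else 0) = a + card (nbrs E v \<inter> insert w W')"
        using wW uW fin by (auto simp: W'_def Int_insert_right)
      finally show ?thesis by simp
    qed
    have cW: "card (insert w W') \<le> 2 * card (insert w WA) + 1"
      using wW uW fin st'(5) by (simp add: W'_def)
    \<comment> \<open>The closure was taken before A's move and with strict inequality, so one more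
      touch by \<open>w\<close> is allowed.\<close>
    have "card (nbrs E v \<inter> insert w W') \<le> g\<^sub>0" if "v \<in> V - set xs" for v
    proof -
      have "card (nbrs E v \<inter> insert w W') \<le> Suc (card (nbrs E v \<inter> W'))"
        using fin wW by (auto simp: Int_insert_right)
      moreover have "card (nbrs E v \<inter> W') < g\<^sub>0" using ys(5) that unfolding xs_def by blast
      ultimately show ?thesis by linarith
    qed
    moreover have "justified (insert w W') (set xs)"
      using ys(4) by (auto intro: justified_mono simp: xs_def)
    moreover have "insert w W' \<subseteq> dom (c'(w \<mapsto> j))" "dom (c'(w \<mapsto> j)) \<subseteq> V"
      using st'(1,2) w(2) u by (auto simp: W'_def c'_def U_def)
    moreover have "insert w WA \<subseteq> set xs \<union> {v \<in> V. a \<le> card (blocked E q (c'(w \<mapsto> j)) v)}"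
      using WA D w(3) by (auto simp: xs_def)
    moreover have "insert w WA \<subseteq> insert w W'" using st'(3) by (auto simp: W'_def)
    moreover have "guarded E (g\<^sub>0 + 1) xs act' (insert w W' \<union> act') 0 i"
      if "i < length xs" "xs ! i \<notin> dom (c'(w \<mapsto> j))" for i
      using w(4) that ys(1) nth_mem[of i xs] by (auto simp: U_def xs_def)
    ultimately show ?thesis
      unfolding stage_def using cW bl ys(1,2,3,5) w(1) by (simp add: xs_def)
  qed
  then show ?thesis using w(2) unfolding U_def c'_def by blast
qed

theorem A_wins: "\<exists>\<sigma>. winning_strategy_A V E q \<sigma>"
proof (rule winning_strategy_A_invariant[where
    Q = "\<lambda>ms. proper_partial_coloring E (map_of ms) \<and> (\<exists>W WA zs act. stage (map_of ms) W WA zs act)"])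
  have empty: "proper_partial_coloring E Map.empty" "blocked E q Map.empty v = {}" for v
  proof -
    have "e - {v} \<noteq> {}" if "e \<in> E" for e v
      using edge[OF that] card_mono[of "{v}" e] by auto
    then show "proper_partial_coloring E Map.empty" "blocked E q Map.empty v = {}"
      by (auto simp: proper_partial_coloring_def blocked_def)
  qed
  have no_loss: "\<not> B_has_won V E q ms"
    if "proper_partial_coloring E (map_of ms)"
      "\<And>v. v \<in> V - dom (map_of ms) \<Longrightarrow> card (blocked E q (map_of ms) v) < q" for ms
    using exists_legal_move that unfolding B_has_won_def by blast
  have legal_proper: "proper_partial_coloring E (map_of (m # ms))"
    if "legal_move V E q ms m" for m ms
    using that by (simp add: legal_move_def)
  \<comment> \<open>When no uncolored vertex is endangered, all bookkeeping is discarded, and an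
    arbitrary legal move opens the next stage.\<close>
  have reset: "\<exists>m'. legal_move V E q ms m' \<and> proper_partial_coloring E (map_of (m' # ms)) \<and>
      (\<exists>W WA zs act. stage (map_of (m' # ms)) W WA zs act)"
    if h: "proper_partial_coloring E (map_of ms)" "dom (map_of ms) \<subseteq> V" "\<not> all_colored V ms"
      "\<And>v. v \<in> V - dom (map_of ms) \<Longrightarrow> card (blocked E q (map_of ms) v) < a" for ms
  proof -
    obtain v where v: "v \<in> V - dom (map_of ms)" using h(3) by (auto simp: all_colored_def)
    then obtain k where k: "legal_move V E q ms (v, k)"
      using exists_legal_move[OF h(1) v] h(4)[OF v] q_large by auto
    then show ?thesis using stage_reset[OF h(2) v h(4), of k] legal_proper[OF k]
      by (intro exI[of _ "(v, k)"]) auto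
  qed
  show "\<not> B_has_won V E q []" using no_loss[of "[]"] empty q_large by simp
  show "\<exists>m. legal_move V E q [] m \<and> proper_partial_coloring E (map_of [m]) \<and>
      (\<exists>W WA zs act. stage (map_of [m]) W WA zs act)" if "\<not> all_colored V []"
    using reset[of "[]"] that empty pos by simp
  fix ms assume Q: "proper_partial_coloring E (map_of ms) \<and> (\<exists>W WA zs act. stage (map_of ms) W WA zs act)"
  then obtain W WA zs act where st: "stage (map_of ms) W WA zs act" by blast
  have bl: "card (blocked E q (map_of ms) v) + 2 \<le> q" if "v \<in> V - dom (map_of ms)" for v
    by (rule stage_blocked[OF st that])
  have "card (blocked E q (map_of ms) v) < q" if "v \<in> V - dom (map_of ms)" for v
    using bl[OF that] by simp
  then show "\<not> B_has_won V E q ms" using Q by (intro no_loss) auto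
  fix m assume m: "legal_move V E q ms m"
  obtain u k where uk: "m = (u, k)" by (cases m)
  have u: "u \<in> V - dom (map_of ms)" using m uk by (simp add: legal_move_def)
  have pr: "proper_partial_coloring E (map_of (m # ms))" using legal_proper[OF m] .
  have bl': "card (blocked E q (map_of (m # ms)) v) < q" if "v \<in> V - dom (map_of (m # ms))" for v
    using bl[of v] card_blocked_update[of E q "map_of ms" u k v] that uk by (auto split: if_splits)
  have domV: "dom (map_of (m # ms)) \<subseteq> V" using st u uk by (auto simp: stage_def)
  have "\<exists>m'. legal_move V E q (m # ms) m' \<and> proper_partial_coloring E (map_of (m' # m # ms)) \<and>
      (\<exists>W WA zs act. stage (map_of (m' # m # ms)) W WA zs act)" if nc: "\<not> all_colored V (m # ms)"
  proof (cases "\<exists>w\<in>V - dom (map_of (m # ms)). a \<le> card (blocked E q (map_of (m # ms)) w)")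
    case True
    have eq: "map_of (m # ms) = (map_of ms)(u \<mapsto> k)" using uk by simp
    from stage_step[OF st u True[unfolded eq]] obtain w where
      w: "w \<in> V - dom (map_of (m # ms))"
        "\<And>j. \<exists>W WA zs act. stage ((map_of (m # ms))(w \<mapsto> j)) W WA zs act"
      unfolding eq by blast
    obtain j where j: "legal_move V E q (m # ms) (w, j)"
      using exists_legal_move[OF pr w(1) bl'[OF w(1)]] by blast
    show ?thesis using j legal_proper[OF j] w(2)[of j] by (intro exI[of _ "(w, j)"]) simp
  next
    case False
    then show ?thesis using reset[OF pr domV nc] by (meson not_less)
  qed
  then show "\<not> B_has_won V E q (m # ms) \<and> (all_colored V (m # ms) \<or>
      (\<exists>m'. legal_move V E q (m # ms) m' \<and> proper_partial_coloring E (map_of (m' # m # ms)) \<and>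
      (\<exists>W WA zs act. stage (map_of (m' # m # ms)) W WA zs act)))"
    using no_loss[OF pr bl'] by blast
qed

end

section \<open>Tail bounds\<close>

lemma finite_uniform_edges [simp]: "finite (uniform_edges r n)"
  by (rule finite_subset[of _ "Pow {1..n}"]) (auto simp: uniform_edges_def)

lemma set_pmf_random_hypergraph: "set_pmf (random_hypergraph r n p) \<subseteq> Pow (uniform_edges r n)"
  by (auto simp: random_hypergraph_def)

text \<open>Markov's inequality for \<open>\<theta>\<close> to the power of the total weight, with
  independence and \<open>1 + x \<le> exp x\<close>. General weights are kept because one edge can
  realize two adjacent pairs at once.\<close>

lemma random_hypergraph_weight_tail:
  fixes w :: "nat set \<Rightarrow> nat" and p \<theta> :: real
  assumes p: "0 \<le> p" "p \<le> 1" and \<theta>: "1 \<le> \<theta>"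
    and B: "p * (\<Sum>e\<in>uniform_edges r n. \<theta> ^ w e - 1) \<le> B"
  shows "measure_pmf.prob (random_hypergraph r n p) {E. m \<le> (\<Sum>e\<in>E. w e)} \<le> exp B / \<theta> ^ m"
proof -
  let ?U = "uniform_edges r n"
  let ?M = "Pi_pmf ?U False (\<lambda>_. bernoulli_pmf p)"
  let ?X = "\<lambda>f. \<Prod>e\<in>?U. if f e then \<theta> ^ w e else 1"
  have X: "?X f = \<theta> ^ (\<Sum>e\<in>{e \<in> ?U. f e}. w e)" for f
    by (simp add: prod.If_cases power_sum Int_def)
  have fin: "finite (set_pmf ?M)"
    by (rule finite_subset[OF set_Pi_pmf_subset']) (auto intro!: finite_PiE_dflt)
  have "measure_pmf.prob (random_hypergraph r n p) {E. m \<le> (\<Sum>e\<in>E. w e)}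
      = measure_pmf.prob ?M {f. m \<le> (\<Sum>e\<in>{e \<in> ?U. f e}. w e)}"
    by (simp add: random_hypergraph_def vimage_def)
  also have "\<dots> \<le> measure_pmf.prob ?M {f \<in> space (measure_pmf ?M). \<theta> ^ m \<le> ?X f}"
    unfolding X using \<theta> by (intro measure_pmf.finite_measure_mono) (auto intro: power_increasing)
  also have "\<dots> \<le> measure_pmf.expectation ?M ?X / \<theta> ^ m"
    using \<theta> fin
    by (intro integral_Markov_inequality_measure[where A = "{}"] integrable_measure_pmf_finite)
       (auto intro!: prod_nonneg)
  also have "measure_pmf.expectation ?M ?X
      = (\<Prod>e\<in>?U. measure_pmf.expectation (bernoulli_pmf p) (\<lambda>b. if b then \<theta> ^ w e else 1))"
    using \<theta> by (intro expectation_prod_Pi_pmf integrable_measure_pmf_finite) auto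
  also have "\<dots> = (\<Prod>e\<in>?U. 1 + p * (\<theta> ^ w e - 1))"
    using p by (intro prod.cong refl) (simp add: algebra_simps)
  also have "\<dots> \<le> (\<Prod>e\<in>?U. exp (p * (\<theta> ^ w e - 1)))"
    using p \<theta> by (intro prod_mono conjI exp_ge_add_one_self add_nonneg_nonneg mult_nonneg_nonneg) auto
  also have "\<dots> = exp (p * (\<Sum>e\<in>?U. \<theta> ^ w e - 1))"
    by (simp add: exp_sum sum_distrib_left)
  also have "\<dots> \<le> exp B" using B by simp
  finally show ?thesis using \<theta> by (simp add: divide_right_mono)
qed

text \<open>It is applied with \<open>\<theta>\<close> about \<open>m / (p * card T)\<close>, the
  ratio of the threshold to the mean; then \<open>B = m\<close> is admissible and the bound becomes
  \<open>(exp 1 / \<theta>) ^ m\<close>.\<close>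

lemma random_hypergraph_count_tail:
  fixes p \<theta> :: real
  assumes p: "0 \<le> p" "p \<le> 1" and \<theta>: "1 \<le> \<theta>" and T: "T \<subseteq> uniform_edges r n"
    and B: "p * \<theta> * real (card T) \<le> B"
  shows "measure_pmf.prob (random_hypergraph r n p) {E. m \<le> card (E \<inter> T)} \<le> exp B / \<theta> ^ m"
proof -
  let ?w = "\<lambda>e. if e \<in> T then 1 else 0 :: nat"
  let ?M = "random_hypergraph r n p"
  have fin: "finite E" if "E \<in> set_pmf ?M" for E
    using that set_pmf_random_hypergraph[of r n p] finite_subset[of E "uniform_edges r n"] by auto
  have "(\<Sum>e\<in>uniform_edges r n. \<theta> ^ ?w e - 1) = (\<Sum>e\<in>T. \<theta> - 1)"
    using T by (intro sum.mono_neutral_cong_right) auto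
  also have "\<dots> \<le> \<theta> * real (card T)" by (simp add: algebra_simps)
  finally have "p * (\<Sum>e\<in>uniform_edges r n. \<theta> ^ ?w e - 1) \<le> p * \<theta> * real (card T)"
    using p by (simp add: mult.assoc mult_left_mono)
  also note B
  finally have "measure_pmf.prob ?M {E. m \<le> (\<Sum>e\<in>E. ?w e)} \<le> exp B / \<theta> ^ m"
    by (rule random_hypergraph_weight_tail[OF p \<theta>])
  moreover have "measure_pmf.prob ?M {E. m \<le> card (E \<inter> T)} = measure_pmf.prob ?M {E. m \<le> (\<Sum>e\<in>E. ?w e)}"
  proof (rule measure_pmf.finite_measure_eq_AE)
    show "AE E in ?M. (E \<in> {E. m \<le> card (E \<inter> T)}) = (E \<in> {E. m \<le> (\<Sum>e\<in>E. ?w e)})"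
      using fin by (auto simp: AE_measure_pmf_iff sum.If_cases)
  qed auto
  ultimately show ?thesis by simp
qed

text \<open>The events have to cover \<open>X\<close> only on the support, where edge sets are known
  to be finite and 3-uniform.\<close>

lemma prob_union_bound:
  assumes "finite I" "\<And>i. i \<in> I \<Longrightarrow> measure_pmf.prob M (A i) \<le> b"
    and "\<And>x. x \<in> set_pmf M \<Longrightarrow> x \<in> X \<Longrightarrow> \<exists>i\<in>I. x \<in> A i"
  shows "measure_pmf.prob M X \<le> real (card I) * b"
proof -
  have "measure_pmf.prob M X = measure_pmf.prob M (X \<inter> set_pmf M)"
    by (simp add: measure_Int_set_pmf)
  also have "\<dots> \<le> measure_pmf.prob M (\<Union>i\<in>I. A i)"
    using assms(3) by (intro measure_pmf.finite_measure_mono) auto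
  also have "\<dots> \<le> (\<Sum>i\<in>I. measure_pmf.prob M (A i))"
    using assms(1) by (intro measure_pmf.finite_measure_subadditive_finite) auto
  also have "\<dots> \<le> (\<Sum>i\<in>I. b)" using assms(2) by (rule sum_mono)
  finally show ?thesis by simp
qed

text \<open>A single term of the expansion of \<open>(1 + 1 / x) ^ n\<close>. With \<open>x\<close>
  free, \<open>x = r\<close> gives one bound that is good for every \<open>k\<close> of order at
  most \<open>n / r\<close>, without dividing by \<open>k\<close>.\<close>

lemma binomial_le_power_exp:
  fixes x :: real
  assumes "0 < x"
  shows "real (n choose k) \<le> x ^ k * exp (real n / x)"
proof (cases "k \<le> n")
  case True
  have "real (n choose k) * (1 / x) ^ k \<le> (\<Sum>i\<le>n. real (n choose i) * (1 / x) ^ i)"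
    using assms True by (intro member_le_sum) auto
  also have "\<dots> = (1 / x + 1) ^ n" by (subst binomial_ring) (simp add: mult.commute)
  also have "\<dots> \<le> exp (1 / x) ^ n"
    using assms exp_ge_add_one_self[of "1 / x"] by (intro power_mono) (auto simp: add.commute)
  also have "\<dots> = exp (real n / x)" by (simp add: exp_of_nat_mult[symmetric])
  finally show ?thesis using assms by (simp add: field_simps power_divide)
qed (use assms in \<open>simp add: binomial_eq_0\<close>)

lemma binomial_le_exp_power:
  assumes "0 < k" "0 < n"
  shows "real (n choose k) \<le> (exp 1 * real n / real k) ^ k"
proof -
  have "real (n choose k) \<le> (real n / real k) ^ k * exp (real n / (real n / real k))"
    using assms by (intro binomial_le_power_exp) auto
  also have "exp (real n / (real n / real k)) = exp 1 ^ k"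
    using assms by (simp add: exp_of_nat_mult[symmetric])
  finally show ?thesis by (simp add: power_mult_distrib power_divide mult_ac)
qed

text \<open>The term \<open>s = 1\<close> dominates. After one factor \<open>s / n\<close> is split
  off, the others are at most 1/4 each; half of that decay pays for \<open>s\<close>, the other half
  makes the sum geometric.\<close>

lemma sum_power_self_le:
  assumes "4 * L \<le> n" "0 < n"
  shows "(\<Sum>s=1..L. (real s / real n) ^ s) \<le> 2 / real n"
proof -
  have summand: "(real s / real n) ^ s \<le> 1 / real n * (1 / 2) ^ (s - 1)" if s: "s \<in> {1..L}" for s
  proof -
    obtain t where t: "s = Suc t" using s by (cases s) auto
    have "(real s / real n) ^ s = real s / real n * (real s / real n) ^ t" using t by simp
    also have "\<dots> \<le> real s / real n * (1 / 4) ^ t"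
      using s assms by (intro mult_left_mono power_mono) (auto simp: field_simps)
    also have "\<dots> = 1 / real n * (1 / 2) ^ t * (real s * (1 / 2) ^ t)"
      by (simp add: power_mult_distrib[symmetric] mult_ac)
    also have "\<dots> \<le> 1 / real n * (1 / 2) ^ t * 1"
    proof (intro mult_left_mono)
      have "Suc t \<le> 2 ^ t" by (induction t) auto
      then have "real s \<le> 2 ^ t" using t by (metis of_nat_le_iff of_nat_numeral of_nat_power)
      then show "real s * (1 / 2) ^ t \<le> 1" by (simp add: power_one_over field_simps)
    qed simp
    finally show ?thesis using t by simp
  qed
  have "(\<Sum>s=1..L. (real s / real n) ^ s) \<le> (\<Sum>s=1..L. 1 / real n * (1 / 2) ^ (s - 1))"
    using summand by (rule sum_mono)
  also have "\<dots> = 1 / real n * (\<Sum>s<L. (1 / 2) ^ s)"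
    by (simp add: sum_distrib_left sum.atLeast1_atMost_eq)
  also have "\<dots> \<le> 1 / real n * 2"
    by (intro mult_left_mono) (auto simp: sum_gp_strict)
  finally show ?thesis by simp
qed

section \<open>Sparsity of the random hypergraph\<close>

lemma uniform_edges_3D:
  assumes "e \<in> uniform_edges 3 n"
  shows "finite e" "card e = 3" "e \<subseteq> {1..n}"
  using assms card_ge_0_finite[of e] by (auto simp: uniform_edges_def)

lemma triple_eq_insert2:
  assumes "card e = 3" "v \<in> e" "x \<in> e" "v \<noteq> x"
  shows "\<exists>z\<in>e. e = {v, x, z}"
proof -
  have fin: "finite e" using assms(1) card_ge_0_finite[of e] by simp
  have "card (e - {v, x}) = 1" using assms fin by (simp add: card_Diff_subset)
  then obtain z where z: "e - {v, x} = {z}" by (auto simp: card_1_singleton_iff)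
  have "e = insert v (insert x (e - {v, x}))" using assms(2,3) by auto
  then have *: "e = {v, x, z}" unfolding z .
  have "z \<in> e - {v, x}" unfolding z by (rule singletonI)
  then have "z \<in> e" by (rule DiffD1)
  with * show ?thesis by (rule bexI)
qed

lemma card_triples_le:
  assumes "finite A" "finite B" "finite C" "\<And>e. e \<in> T \<Longrightarrow> \<exists>x\<in>A. \<exists>y\<in>B. \<exists>z\<in>C. e = {x, y, z}"
  shows "card T \<le> card A * card B * card C"
proof -
  have "e \<in> (\<lambda>(x, y, z). {x, y, z}) ` (A \<times> B \<times> C)" if e: "e \<in> T" for e
  proof -
    obtain x y z where "x \<in> A" "y \<in> B" "z \<in> C" "e = {x, y, z}" using assms(4)[OF e] by blast
    then show ?thesis by (intro image_eqI[of _ _ "(x, y, z)"]) auto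
  qed
  then have "card T \<le> card ((\<lambda>(x, y, z). {x, y, z}) ` (A \<times> B \<times> C))"
    using assms(1-3) by (intro card_mono) auto
  also have "\<dots> \<le> card (A \<times> B \<times> C)" using assms by (intro card_image_le) auto
  finally show ?thesis by (simp add: card_cartesian_product)
qed

lemma card_distinct_pairs:
  assumes "card e = 3"
  shows "card {(v, x). v \<in> e \<and> x \<in> e \<and> v \<noteq> x} = 6"
proof -
  have fin: "finite e" using assms card_ge_0_finite[of e] by simp
  have "{(v, x). v \<in> e \<and> x \<in> e \<and> v \<noteq> x} = e \<times> e - (\<lambda>v. (v, v)) ` e" by auto
  also have "card \<dots> = card (e \<times> e) - card ((\<lambda>v. (v, v)) ` e)"
    using fin by (intro card_Diff_subset) auto
  also have "card ((\<lambda>v. (v, v)) ` e) = 3" using assms by (subst card_image) (auto intro: inj_onI)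
  finally show ?thesis using assms by (simp add: card_cartesian_product)
qed

lemma card_adjacent_pairs_le:
  assumes "finite F" "\<And>e. e \<in> F \<Longrightarrow> card e = 3"
    and "\<And>v x. (v, x) \<in> R \<Longrightarrow> v \<noteq> x \<and> (\<exists>e\<in>F. v \<in> e \<and> x \<in> e)"
  shows "card R \<le> 6 * card F"
proof -
  let ?A = "\<lambda>e. {(v, x). v \<in> e \<and> x \<in> e \<and> v \<noteq> x}"
  have "finite (?A e)" if "e \<in> F" for e
    using card_distinct_pairs[OF assms(2)[OF that]] by (intro card_ge_0_finite) simp
  then have "finite (\<Union>e\<in>F. ?A e)" using assms(1) by blast
  moreover have "R \<subseteq> (\<Union>e\<in>F. ?A e)"
  proof
    fix z assume "z \<in> R"
    then show "z \<in> (\<Union>e\<in>F. ?A e)" using assms(3)[of "fst z" "snd z"] by (cases z) auto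
  qed
  ultimately have "card R \<le> card (\<Union>e\<in>F. ?A e)" by (rule card_mono)
  also have "\<dots> \<le> (\<Sum>e\<in>F. card (?A e))" using assms(1) by (rule card_UN_le)
  also have "\<dots> = (\<Sum>e\<in>F. 6)" using assms(2) card_distinct_pairs by (intro sum.cong) auto
  finally show ?thesis by simp
qed

lemma exp_div_power_eq: "exp (real k) / \<theta> ^ k = (exp 1 / \<theta>) ^ k"
  by (simp add: power_divide exp_of_nat_mult[symmetric])

lemma card_subsets_of_card: "card {S. S \<subseteq> {1..n::nat} \<and> card S = s} = n choose s"
  using n_subsets[of "{1..n}" s] by simp

lemma finite_subsets_of_card: "finite {S. S \<subseteq> {1..n::nat} \<and> card S = s}"
  by (rule finite_subset[of _ "Pow {1..n}"]) auto

section \<open>Union bounds for the failure events\<close>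

context
  fixes n :: nat and d p :: real and M :: "nat set set pmf"
  assumes n_pos: "0 < n" and d_pos: "0 < d" and p_eq: "p = d / real n ^ 2" and p_le: "p \<le> 1"
  defines "M \<equiv> random_hypergraph 3 n p"
begin

lemma p_nonneg: "0 \<le> p"
  using d_pos by (simp add: p_eq)

lemma edges_in_support:
  assumes "E \<in> set_pmf M"
  shows "finite E" "E \<subseteq> uniform_edges 3 n"
  using assms set_pmf_random_hypergraph[of 3 n p] finite_subset[of E "uniform_edges 3 n"]
  by (auto simp: M_def)

text \<open>The \<open>8 * r * s\<close> adjacent pairs between the attacked vertices and
  \<open>W\<close> need at least \<open>r * s\<close> edges, as an edge contains only six ordered
  pairs. The expected number is at most \<open>s * w * d / n\<close>, hence at most
  \<open>7 * d * s / r\<close>, which is smaller by the factor \<open>\<theta>\<close>.\<close>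

lemma prob_many_attacked:
  assumes r: "0 < r" "7 * d \<le> real r ^ 2" and w: "w \<le> n" "real w * real r \<le> 7 * real n"
  shows "measure_pmf.prob M {E. \<exists>W\<subseteq>{1..n}. card W \<le> w \<and>
      s \<le> card {v \<in> {1..n}. 8 * r \<le> card (nbrs E v \<inter> W)}}
    \<le> real (n choose w) * real (n choose s) * (7 * exp 1 * d / real r ^ 2) ^ (r * s)"
proof -
  define T where "T = (\<lambda>(W, S). {e \<in> uniform_edges 3 n. \<exists>v\<in>e \<inter> S. \<exists>x\<in>e \<inter> W. v \<noteq> x})"
  define I where "I = {W. W \<subseteq> {1..n} \<and> card W = w} \<times> {S. S \<subseteq> {1..n} \<and> card S = s}"
  define \<theta> where "\<theta> = real r ^ 2 / (7 * d)"
  have \<theta>: "1 \<le> \<theta>" using r d_pos by (simp add: \<theta>_def field_simps)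
  have "measure_pmf.prob M {E. \<exists>W\<subseteq>{1..n}. card W \<le> w \<and>
      s \<le> card {v \<in> {1..n}. 8 * r \<le> card (nbrs E v \<inter> W)}}
    \<le> real (card I) * ((exp 1 / \<theta>) ^ (r * s))"
  proof (rule prob_union_bound)
    show "finite I" unfolding I_def by (intro finite_cartesian_product finite_subsets_of_card)
    show "measure_pmf.prob M {E. r * s \<le> card (E \<inter> T i)} \<le> (exp 1 / \<theta>) ^ (r * s)" if iI: "i \<in> I" for i
    proof -
      obtain W S where i: "i = (W, S)" "W \<subseteq> {1..n}" "card W = w" "S \<subseteq> {1..n}" "card S = s"
        using iI by (auto simp: I_def)
      have "card (T i) \<le> card S * card W * card {1..n}"
      proof (rule card_triples_le)
        fix e assume "e \<in> T i"
        then obtain v x where e: "e \<in> uniform_edges 3 n" "v \<in> e \<inter> S" "x \<in> e \<inter> W" "v \<noteq> x"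
          by (auto simp: T_def i)
        then show "\<exists>x\<in>S. \<exists>y\<in>W. \<exists>z\<in>{1..n}. e = {x, y, z}"
          using triple_eq_insert2[of e v x] uniform_edges_3D[OF e(1)] by blast
      qed (use i finite_subset in auto)
      then have "real (card (T i)) \<le> real (s * w * n)" using i by (intro of_nat_mono) auto
      then have "p * \<theta> * real (card (T i)) \<le> p * \<theta> * real (s * w * n)"
        using p_nonneg \<theta> by (intro mult_left_mono) auto
      also have "\<dots> = real r * real s * (real w * real r / (7 * real n))"
        using n_pos d_pos by (simp add: p_eq \<theta>_def power2_eq_square field_simps)
      also have "\<dots> \<le> real r * real s * 1"
        using w n_pos by (intro mult_left_mono) (auto simp: field_simps)
      finally have *: "p * \<theta> * real (card (T i)) \<le> real (r * s)" by simp
      have "T i \<subseteq> uniform_edges 3 n" by (auto simp: T_def i)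
      from random_hypergraph_count_tail[OF p_nonneg p_le \<theta> this *, where m = "r * s"] show ?thesis
        unfolding M_def exp_div_power_eq .
    qed
    fix E assume E: "E \<in> set_pmf M" and "E \<in> {E. \<exists>W\<subseteq>{1..n}. card W \<le> w \<and>
      s \<le> card {v \<in> {1..n}. 8 * r \<le> card (nbrs E v \<inter> W)}}"
    then obtain W where W: "W \<subseteq> {1..n}" "card W \<le> w"
      "s \<le> card {v \<in> {1..n}. 8 * r \<le> card (nbrs E v \<inter> W)}" by blast
    \<comment> \<open>Enlarging \<open>W\<close> only adds touches, so the union bound can range
      over sets of a single size.\<close>
    obtain W' where W': "W \<subseteq> W'" "W' \<subseteq> {1..n}" "card W' = w"
      using exists_subset_between[of W w "{1..n}"] W w by auto
    obtain S where S: "S \<subseteq> {v \<in> {1..n}. 8 * r \<le> card (nbrs E v \<inter> W)}" "card S = s" "finite S"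
      using obtain_subset_with_card_n[OF W(3)] .
    have finW: "finite W'" using W' finite_subset by blast
    define F where "F = E \<inter> T (W', S)"
    define R where "R = (SIGMA v:S. nbrs E v \<inter> W')"
    have "card R = (\<Sum>v\<in>S. card (nbrs E v \<inter> W'))"
      unfolding R_def using S finW by (intro card_SigmaI) auto
    moreover have "8 * r \<le> card (nbrs E v \<inter> W')" if "v \<in> S" for v
    proof -
      have "8 * r \<le> card (nbrs E v \<inter> W)" using that S by auto
      also have "\<dots> \<le> card (nbrs E v \<inter> W')" using W'(1) finW by (intro card_mono) auto
      finally show ?thesis .
    qed
    then have "of_nat (card S) * (8 * r) \<le> (\<Sum>v\<in>S. card (nbrs E v \<inter> W'))"
      by (intro sum_bounded_below)
    moreover have "card R \<le> 6 * card F"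
    proof (rule card_adjacent_pairs_le)
      show "finite F" using edges_in_support[OF E] by (auto simp: F_def)
      show "card e = 3" if "e \<in> F" for e using that uniform_edges_3D by (auto simp: F_def T_def)
      show "v \<noteq> x \<and> (\<exists>e\<in>F. v \<in> e \<and> x \<in> e)" if vx: "(v, x) \<in> R" for v x
      proof -
        obtain e where "e \<in> E" "v \<in> e" "x \<in> e" "x \<noteq> v" "v \<in> S" "x \<in> W'"
          using vx by (auto simp: R_def nbrs_def)
        moreover from this have "\<exists>v\<in>e \<inter> S. \<exists>x\<in>e \<inter> W'. v \<noteq> x"
          by (intro bexI[of _ v] bexI[of _ x]) auto
        then have "e \<in> F" using edges_in_support[OF E] \<open>e \<in> E\<close> by (auto simp: F_def T_def)
        ultimately show ?thesis by auto
      qed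
    qed
    ultimately have "r * s \<le> card F" using S(2) by (simp add: algebra_simps)
    then show "\<exists>i\<in>I. E \<in> {E. r * s \<le> card (E \<inter> T i)}"
      using W' S by (intro bexI[of _ "(W', S)"]) (auto simp: I_def F_def)
  qed
  moreover have "card I = (n choose w) * (n choose s)"
    unfolding I_def card_cartesian_product card_subsets_of_card ..
  moreover have "exp 1 / \<theta> = 7 * exp 1 * d / real r ^ 2" by (simp add: \<theta>_def)
  ultimately show ?thesis by simp
qed

text \<open>The expected number of edges meeting \<open>S\<close> twice is at most
  \<open>s^2 * d / n\<close>; \<open>\<theta>\<close> is the ratio of the threshold
  \<open>h * s\<close> to it.\<close>

lemma prob_many_internal_edges:
  assumes s: "0 < s" "real s * d \<le> real h * real n"
  shows "measure_pmf.prob M {E. \<exists>S\<subseteq>{1..n}. card S = s \<and> h * s \<le> card {e \<in> E. 2 \<le> card (e \<inter> S)}}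
    \<le> real (n choose s) * (exp 1 * real s * d / (real h * real n)) ^ (h * s)"
proof -
  define T where "T = (\<lambda>S. {e \<in> uniform_edges 3 n. 2 \<le> card (e \<inter> S)})"
  define I where "I = {S. S \<subseteq> {1..n} \<and> card S = s}"
  define \<theta> where "\<theta> = real h * real n / (real s * d)"
  have \<theta>: "1 \<le> \<theta>" using s d_pos by (simp add: \<theta>_def field_simps)
  have "measure_pmf.prob M {E. \<exists>S\<subseteq>{1..n}. card S = s \<and> h * s \<le> card {e \<in> E. 2 \<le> card (e \<inter> S)}}
    \<le> real (card I) * ((exp 1 / \<theta>) ^ (h * s))"
  proof (rule prob_union_bound)
    show "finite I" unfolding I_def by (rule finite_subsets_of_card)
    show "measure_pmf.prob M {E. h * s \<le> card (E \<inter> T S)} \<le> (exp 1 / \<theta>) ^ (h * s)" if "S \<in> I" for S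
    proof -
      have S: "S \<subseteq> {1..n}" "card S = s" using that by (auto simp: I_def)
      have "card (T S) \<le> card S * card S * card {1..n}"
      proof (rule card_triples_le)
        fix e assume e: "e \<in> T S"
        then have "2 \<le> card (e \<inter> S)" by (simp add: T_def)
        then obtain S' where S': "S' \<subseteq> e \<inter> S" "card S' = 2" "finite S'"
          by (rule obtain_subset_with_card_n)
        obtain v x where vx: "S' = {v, x}" "v \<noteq> x" using S'(2) unfolding card_2_iff by blast
        have eU: "e \<in> uniform_edges 3 n" using e by (simp add: T_def)
        have "v \<in> e" "x \<in> e" "v \<in> S" "x \<in> S" using S'(1) vx(1) by auto
        moreover from this obtain z where "z \<in> e" "e = {v, x, z}"
          using triple_eq_insert2[OF uniform_edges_3D(2)[OF eU] _ _ vx(2)] by blast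
        moreover from this have "z \<in> {1..n}" using uniform_edges_3D(3)[OF eU] by blast
        ultimately show "\<exists>x\<in>S. \<exists>y\<in>S. \<exists>z\<in>{1..n}. e = {x, y, z}" by blast
      qed (use S finite_subset in auto)
      then have "real (card (T S)) \<le> real (s * s * n)" using S by (intro of_nat_mono) auto
      then have "p * \<theta> * real (card (T S)) \<le> p * \<theta> * real (s * s * n)"
        using p_nonneg \<theta> by (intro mult_left_mono) auto
      also have "\<dots> = real (h * s)"
        using n_pos d_pos s by (simp add: p_eq \<theta>_def power2_eq_square field_simps)
      finally have *: "p * \<theta> * real (card (T S)) \<le> real (h * s)" .
      have "T S \<subseteq> uniform_edges 3 n" by (auto simp: T_def)
      from random_hypergraph_count_tail[OF p_nonneg p_le \<theta> this *, where m = "h * s"] show ?thesis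
        unfolding M_def exp_div_power_eq .
    qed
    fix E assume E: "E \<in> set_pmf M" and "E \<in> {E. \<exists>S\<subseteq>{1..n}. card S = s \<and>
      h * s \<le> card {e \<in> E. 2 \<le> card (e \<inter> S)}}"
    then obtain S where "S \<subseteq> {1..n}" "card S = s" "h * s \<le> card {e \<in> E. 2 \<le> card (e \<inter> S)}" by blast
    moreover have "{e \<in> E. 2 \<le> card (e \<inter> S)} = E \<inter> T S"
      using edges_in_support[OF E] by (auto simp: T_def)
    ultimately show "\<exists>S\<in>I. E \<in> {E. h * s \<le> card (E \<inter> T S)}" by (auto simp: I_def)
  qed
  moreover have "card I = n choose s" unfolding I_def card_subsets_of_card ..
  moreover have "exp 1 / \<theta> = exp 1 * real s * d / (real h * real n)" by (simp add: \<theta>_def)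
  ultimately show ?thesis by simp
qed

text \<open>This is the source of the exponent 2/3. Up to constants and the choice of
  \<open>S\<close>, choosing \<open>X\<close> costs \<open>(n / (r * s)) ^ (r * s)\<close>, so the
  bound is \<open>(s * d^2 / (r * n)) ^ (r * s)\<close>; for \<open>s\<close> of order
  \<open>n / r^2\<close> it is small when \<open>r^3\<close> exceeds \<open>d^2\<close>.\<close>

lemma prob_dense_pair:
  assumes s: "0 < s" "real s * d \<le> real n" and r: "real r + 1 \<le> d"
  shows "measure_pmf.prob M {E. \<exists>S\<subseteq>{1..n}. \<exists>X\<subseteq>{1..n} - S. card S = s \<and> card X = r * s \<and>
      2 * (r * s) \<le> (\<Sum>e\<in>E. card (e \<inter> S) * card (e \<inter> X))}
    \<le> real (n choose s) * real (n choose (r * s)) * (exp 1 * real s * d / real n) ^ (2 * (r * s))"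
proof -
  define I where "I = {(S, X). S \<subseteq> {1..n} \<and> X \<subseteq> {1..n} - S \<and> card S = s \<and> card X = r * s}"
  define \<theta> where "\<theta> = real n / (real s * d)"
  have \<theta>: "1 \<le> \<theta>" using s d_pos by (simp add: \<theta>_def field_simps)
  have IJ: "I \<subseteq> {S. S \<subseteq> {1..n} \<and> card S = s} \<times> {X. X \<subseteq> {1..n} \<and> card X = r * s}" (is "_ \<subseteq> ?J")
    by (auto simp: I_def)
  have finJ: "finite ?J" by (intro finite_cartesian_product finite_subsets_of_card)
  have "measure_pmf.prob M {E. \<exists>S\<subseteq>{1..n}. \<exists>X\<subseteq>{1..n} - S. card S = s \<and> card X = r * s \<and>
      2 * (r * s) \<le> (\<Sum>e\<in>E. card (e \<inter> S) * card (e \<inter> X))}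
    \<le> real (card I) * ((exp 1 / \<theta>) ^ (2 * (r * s)))"
  proof (rule prob_union_bound)
    show "finite I" using IJ finJ finite_subset by blast
    show "measure_pmf.prob M (case i of (S, X) \<Rightarrow>
        {E. 2 * (r * s) \<le> (\<Sum>e\<in>E. card (e \<inter> S) * card (e \<inter> X))}) \<le> (exp 1 / \<theta>) ^ (2 * (r * s))"
      if iI: "i \<in> I" for i
    proof -
      obtain S X where i: "i = (S, X)" "S \<subseteq> {1..n}" "X \<subseteq> {1..n} - S" "card S = s" "card X = r * s"
        using iI by (auto simp: I_def)
      have fin: "finite S" "finite X" using i(2,3) finite_subset by blast+
      let ?w = "\<lambda>e. card (e \<inter> S) * card (e \<inter> X)"
      define A where "A = {e \<in> uniform_edges 3 n. ?w e = 1}"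
      define B where "B = {e \<in> uniform_edges 3 n. ?w e = 2}"
      have sum_le: "card (e \<inter> S) + card (e \<inter> X) \<le> 3" if "e \<in> uniform_edges 3 n" for e
      proof -
        have "card (e \<inter> S) + card (e \<inter> X) = card (e \<inter> S \<union> e \<inter> X)"
          using i(3) fin by (intro card_Un_disjoint[symmetric]) auto
        also have "\<dots> \<le> card e" using uniform_edges_3D[OF that] by (intro card_mono) auto
        finally show ?thesis using uniform_edges_3D[OF that] by simp
      qed
      have w: "?w e = 0 \<or> ?w e = 1 \<or> ?w e = 2" if "e \<in> uniform_edges 3 n" for e
      proof -
        have "card (e \<inter> S) \<in> {0, 1, 2, 3}" "card (e \<inter> X) \<in> {0, 1, 2, 3}" using sum_le[OF that] by auto
        then show ?thesis using sum_le[OF that] by auto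
      qed
      have ex: "\<exists>v\<in>e \<inter> S. \<exists>x\<in>e \<inter> X. \<exists>z\<in>e. v \<noteq> x \<and> e = {v, x, z}" if "e \<in> uniform_edges 3 n" "?w e \<noteq> 0" for e
      proof -
        have "e \<inter> S \<noteq> {}" "e \<inter> X \<noteq> {}" using that(2) by auto
        then obtain v x where "v \<in> e \<inter> S" "x \<in> e \<inter> X" by blast
        moreover from this have "v \<noteq> x" using i(3) by auto
        ultimately show ?thesis using triple_eq_insert2[of e v x] uniform_edges_3D[OF that(1)] by blast
      qed
      have "card A \<le> card S * card X * card {1..n}"
      proof (rule card_triples_le)
        fix e assume e: "e \<in> A"
        then have "?w e \<noteq> 0" by (simp add: A_def)
        then show "\<exists>x\<in>S. \<exists>y\<in>X. \<exists>z\<in>{1..n}. e = {x, y, z}"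
          using ex[of e] uniform_edges_3D[of e n] e unfolding A_def by blast
      qed (use fin in auto)
      then have A: "real (card A) \<le> real s * real (r * s) * real n"
        using i by (metis card_atLeastAtMost diff_Suc_1 of_nat_mono of_nat_mult)
      have "card B \<le> card S * card X * card (S \<union> X)"
      proof (rule card_triples_le)
        fix e assume e: "e \<in> B"
        then obtain v x z where z: "v \<in> e \<inter> S" "x \<in> e \<inter> X" "z \<in> e" "v \<noteq> x" "e = {v, x, z}"
          using ex[of e] by (auto simp: B_def)
        have "z \<in> S \<union> X"
        proof (rule ccontr)
          assume "z \<notin> S \<union> X"
          then have "e \<inter> S \<subseteq> {v}" "e \<inter> X \<subseteq> {x}" using z i(3) by auto
          then have "card (e \<inter> S) \<le> 1" "card (e \<inter> X) \<le> 1"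
            using card_mono[of "{v}" "e \<inter> S"] card_mono[of "{x}" "e \<inter> X"] by auto
          then have "?w e \<le> 1 * 1" by (rule mult_le_mono)
          then show False using e by (simp add: B_def)
        qed
        then show "\<exists>x\<in>S. \<exists>y\<in>X. \<exists>z\<in>S \<union> X. e = {x, y, z}" using z by blast
      qed (use fin in auto)
      also have "\<dots> \<le> s * (r * s) * (s + r * s)"
        using i card_Un_le[of S X] by (intro mult_le_mono) auto
      finally have B: "real (card B) \<le> real s * real (r * s) * (real s + real (r * s))"
        by (metis of_nat_add of_nat_mono of_nat_mult)
      have "(\<Sum>e\<in>uniform_edges 3 n. \<theta> ^ ?w e - 1)
          \<le> (\<Sum>e\<in>uniform_edges 3 n. (if e \<in> A then \<theta> else 0) + (if e \<in> B then \<theta>\<^sup>2 else 0))"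
      proof (rule sum_mono)
        fix e assume e: "e \<in> uniform_edges 3 n"
        show "\<theta> ^ ?w e - 1 \<le> (if e \<in> A then \<theta> else 0) + (if e \<in> B then \<theta>\<^sup>2 else 0)"
          using w[OF e] e \<theta> by (auto simp: A_def B_def)
      qed
      also have "\<dots> = \<theta> * real (card A) + \<theta>\<^sup>2 * real (card B)"
      proof -
        have "uniform_edges 3 n \<inter> A = A" "uniform_edges 3 n \<inter> B = B" by (auto simp: A_def B_def)
        then show ?thesis by (simp add: sum.distrib sum.If_cases)
      qed
      finally have "p * (\<Sum>e\<in>uniform_edges 3 n. \<theta> ^ ?w e - 1)
          \<le> p * (\<theta> * real (card A) + \<theta>\<^sup>2 * real (card B))"
        using p_nonneg by (rule mult_left_mono)
      also have "\<dots> \<le> p * (\<theta> * (real s * real (r * s) * real n)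
          + \<theta>\<^sup>2 * (real s * real (r * s) * (real s + real (r * s))))"
        using p_nonneg \<theta> A B by (intro mult_left_mono add_mono) auto
      \<comment> \<open>Edges of weight 2 gain the larger factor \<open>\<theta>\<^sup>2\<close>,
        but all their vertices lie in \<open>S \<union> X\<close>, so they are rarer;
        \<open>r + 1 \<le> d\<close> makes their share no larger than that of weight 1.\<close>
      also have "\<dots> = real (r * s) + real (r * s) * ((real r + 1) / d)"
        using n_pos d_pos s by (simp add: p_eq \<theta>_def power2_eq_square field_simps)
      also have "\<dots> \<le> real (r * s) + real (r * s) * 1"
        using r d_pos by (intro add_left_mono mult_left_mono) (auto simp: field_simps)
      also have "\<dots> = real (2 * (r * s))" by simp
      finally have "p * (\<Sum>e\<in>uniform_edges 3 n. \<theta> ^ ?w e - 1) \<le> real (2 * (r * s))" .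
      from random_hypergraph_weight_tail[OF p_nonneg p_le \<theta> this, where m = "2 * (r * s)"]
      show ?thesis unfolding M_def exp_div_power_eq i prod.case .
    qed
  qed (auto simp: I_def)
  also have "\<dots> \<le> real ((n choose s) * (n choose (r * s))) * ((exp 1 / \<theta>) ^ (2 * (r * s)))"
  proof (intro mult_right_mono of_nat_mono)
    show "card I \<le> (n choose s) * (n choose (r * s))"
      using card_mono[OF finJ IJ] unfolding card_cartesian_product card_subsets_of_card .
  qed (use \<theta> in simp)
  also have "exp 1 / \<theta> = exp 1 * real s * d / real n" by (simp add: \<theta>_def)
  finally show ?thesis by simp
qed

text \<open>Colors with classes above \<open>n / (8 * r)\<close> are set aside: a huge class would
  by itself block its color at many vertices, but there are at most \<open>8 * r\<close> such
  colors. At least \<open>16 * r\<close> of the blocked colors are then small, and the squares of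
  small class sizes sum to at most \<open>n^2 / (8 * r)\<close>, which bounds the number of
  candidate edges.\<close>

lemma prob_many_endangered:
  assumes r: "0 < r" "d \<le> 40 * real r ^ 2"
  shows "measure_pmf.prob M {E. \<exists>c. s \<le> card {v \<in> {1..n}. 24 * r \<le> card (blocked E q c v)}}
    \<le> (2 * (real q + 1)) ^ n * (exp 1 * d / (40 * real r ^ 2)) ^ (5 * (r * s))"
proof -
  define cls :: "(nat \<Rightarrow> nat) \<Rightarrow> nat \<Rightarrow> nat set" where "cls C k = {x \<in> {1..n}. C x = k}" for C k
  define small where "small C = {k \<in> {1..q}. 8 * r * card (cls C k) \<le> n}" for C
  define T where "T = (\<lambda>(C, S). {e \<in> uniform_edges 3 n. \<exists>v\<in>e \<inter> S. \<exists>k\<in>small C. e - {v} \<subseteq> cls C k})"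
  define I where "I = ({1..n} \<rightarrow>\<^sub>E {0..q}) \<times> {S. S \<subseteq> {1..n} \<and> card S = s}"
  define \<theta> where "\<theta> = 40 * real r ^ 2 / d"
  have \<theta>: "1 \<le> \<theta>" using r d_pos by (simp add: \<theta>_def field_simps)
  have fin_cls [simp]: "finite (cls C k)" for C k by (simp add: cls_def)
  have sum_cls: "(\<Sum>k\<in>K. card (cls C k)) \<le> n" if "finite K" for C K
  proof -
    have "(\<Sum>k\<in>K. card (cls C k)) = card (\<Union>k\<in>K. cls C k)"
      using that by (intro card_UN_disjoint[symmetric]) (auto simp: cls_def)
    also have "\<dots> \<le> card {1..n}" by (intro card_mono) (auto simp: cls_def)
    finally show ?thesis by simp
  qed
  have fin_small [simp]: "finite (small C)" for C by (simp add: small_def)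
  have "measure_pmf.prob M {E. \<exists>c. s \<le> card {v \<in> {1..n}. 24 * r \<le> card (blocked E q c v)}}
    \<le> real (card I) * ((exp 1 / \<theta>) ^ (5 * (r * s)))"
  proof (rule prob_union_bound)
    show "finite I" unfolding I_def
      by (intro finite_cartesian_product finite_subsets_of_card finite_PiE) auto
    show "measure_pmf.prob M {E. 5 * (r * s) \<le> card (E \<inter> T i)} \<le> (exp 1 / \<theta>) ^ (5 * (r * s))"
      if iI: "i \<in> I" for i
    proof -
      obtain C S where i: "i = (C, S)" "S \<subseteq> {1..n}" "card S = s" using iI by (auto simp: I_def)
      have finS: "finite S" using i finite_subset by blast
      have "T i \<subseteq> (\<Union>k\<in>small C. {e \<in> uniform_edges 3 n. \<exists>v\<in>e \<inter> S. e - {v} \<subseteq> cls C k})"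
        by (auto simp: T_def i)
      then have "card (T i) \<le> card (\<Union>k\<in>small C. {e \<in> uniform_edges 3 n. \<exists>v\<in>e \<inter> S. e - {v} \<subseteq> cls C k})"
        by (intro card_mono) auto
      also have "\<dots> \<le> (\<Sum>k\<in>small C. card {e \<in> uniform_edges 3 n. \<exists>v\<in>e \<inter> S. e - {v} \<subseteq> cls C k})"
        by (intro card_UN_le) simp
      also have "\<dots> \<le> (\<Sum>k\<in>small C. card S * card (cls C k) * card (cls C k))"
      proof (intro sum_mono card_triples_le)
        fix k e assume "e \<in> {e \<in> uniform_edges 3 n. \<exists>v\<in>e \<inter> S. e - {v} \<subseteq> cls C k}"
        then obtain v where v: "e \<in> uniform_edges 3 n" "v \<in> e" "v \<in> S" "e - {v} \<subseteq> cls C k" by blast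
        note e = uniform_edges_3D[OF v(1)]
        have "card (e - {v}) = 2" using v e by simp
        then obtain x y where "e - {v} = {x, y}" unfolding card_2_iff by blast
        moreover have "e = insert v (e - {v})" using v(2) by auto
        ultimately have "e = {v, x, y}" "x \<in> cls C k" "y \<in> cls C k" using v(4) by auto
        then show "\<exists>x\<in>S. \<exists>y\<in>cls C k. \<exists>z\<in>cls C k. e = {x, y, z}" using v(3) by blast
      qed (use finS in auto)
      finally have "8 * r * card (T i) \<le> 8 * r * (\<Sum>k\<in>small C. card S * card (cls C k) * card (cls C k))"
        by simp
      also have "\<dots> = s * (\<Sum>k\<in>small C. (8 * r * card (cls C k)) * card (cls C k))"
        by (simp add: sum_distrib_left i mult_ac)
      also have "\<dots> \<le> s * (\<Sum>k\<in>small C. n * card (cls C k))"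
        by (intro mult_left_mono sum_mono mult_right_mono) (auto simp: small_def)
      also have "\<dots> \<le> s * (n * n)"
        unfolding sum_distrib_left[symmetric] by (intro mult_left_mono sum_cls) auto
      finally have "8 * real r * real (card (T i)) \<le> real s * (real n * real n)"
        by (metis of_nat_mono of_nat_mult of_nat_numeral)
      then have "5 * real r / (real n)\<^sup>2 * (8 * real r * real (card (T i)))
          \<le> 5 * real r / (real n)\<^sup>2 * (real s * (real n * real n))"
        by (intro mult_left_mono) auto
      then have *: "p * \<theta> * real (card (T i)) \<le> real (5 * (r * s))"
        using n_pos d_pos by (simp add: p_eq \<theta>_def power2_eq_square field_simps)
      have "T i \<subseteq> uniform_edges 3 n" by (auto simp: T_def i)
      from random_hypergraph_count_tail[OF p_nonneg p_le \<theta> this *, where m = "5 * (r * s)"]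
      show ?thesis unfolding M_def exp_div_power_eq .
    qed
    fix E assume E: "E \<in> set_pmf M"
      and "E \<in> {E. \<exists>c. s \<le> card {v \<in> {1..n}. 24 * r \<le> card (blocked E q c v)}}"
    then obtain c where "s \<le> card {v \<in> {1..n}. 24 * r \<le> card (blocked E q c v)}" by blast
    then obtain S where S: "S \<subseteq> {v \<in> {1..n}. 24 * r \<le> card (blocked E q c v)}" "card S = s" "finite S"
      by (rule obtain_subset_with_card_n)
    note E' = edges_in_support[OF E]
    \<comment> \<open>The value 0 stands for uncolored and for colors outside the palette. It is no
      member of \<open>{1..q}\<close>, so this class never blocks anything.\<close>
    define C where "C = restrict (\<lambda>v. case c v of None \<Rightarrow> 0 | Some k \<Rightarrow> if k \<le> q then k else 0) {1..n}"
    have C: "C \<in> {1..n} \<rightarrow>\<^sub>E {0..q}" by (auto simp: C_def split: option.splits)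
    define big where "big = {1..q} - small C"
    have big: "card big \<le> 8 * r"
    proof -
      have "card big * n \<le> (\<Sum>k\<in>big. 8 * r * card (cls C k))"
        by (intro sum_bounded_below[where 'a = nat, simplified]) (auto simp: big_def small_def)
      also have "\<dots> = 8 * r * (\<Sum>k\<in>big. card (cls C k))" by (simp add: sum_distrib_left)
      also have "\<dots> \<le> 8 * r * n" by (intro mult_left_mono sum_cls) (auto simp: big_def)
      finally show ?thesis using n_pos by simp
    qed
    define R where "R = (SIGMA v:S. blocked E q c v \<inter> small C)"
    define F where "F = E \<inter> T (C, S)"
    have "\<forall>vk\<in>R. \<exists>e. e \<in> F \<and> fst vk \<in> e \<and> e - {fst vk} \<subseteq> cls C (snd vk)"
    proof
      fix vk assume "vk \<in> R"
      then obtain v k where vk: "vk = (v, k)" "v \<in> S" "k \<in> blocked E q c v" "k \<in> small C"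
        by (auto simp: R_def)
      then obtain e where e: "e \<in> E" "v \<in> e" "\<forall>u\<in>e - {v}. c u = Some k" "k \<in> {1..q}"
        by (auto simp: blocked_def)
      have eU: "e \<in> uniform_edges 3 n" using E' e by blast
      have "e - {v} \<subseteq> cls C k"
        using e uniform_edges_3D(3)[OF eU] by (auto simp: cls_def C_def)
      moreover from this have "e \<in> T (C, S)" using eU e(2) vk unfolding T_def by auto
      ultimately show "\<exists>e. e \<in> F \<and> fst vk \<in> e \<and> e - {fst vk} \<subseteq> cls C (snd vk)"
        using e vk by (auto simp: F_def)
    qed
    then obtain f where f: "\<forall>vk\<in>R. f vk \<in> F \<and> fst vk \<in> f vk \<and> f vk - {fst vk} \<subseteq> cls C (snd vk)"
      by (rule bchoice[THEN exE])
    have F3: "finite e \<and> card e = 3" if "e \<in> F" for e using that uniform_edges_3D E' by (auto simp: F_def)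
    have finF: "finite F" using E' by (simp add: F_def)
    \<comment> \<open>A witnessing edge together with its vertex \<open>v\<close> determines the
      color, since the other two vertices carry it. Hence an edge serves at most three
      pairs.\<close>
    have "inj_on (\<lambda>vk. (f vk, fst vk)) R"
    proof (rule inj_onI)
      fix x y assume xy: "x \<in> R" "y \<in> R" "(f x, fst x) = (f y, fst y)"
      have fx: "f x \<in> F" "fst x \<in> f x" "f x - {fst x} \<subseteq> cls C (snd x)" using f xy(1) by auto
      have "f x - {fst x} \<subseteq> cls C (snd y)" using f xy(2,3) by auto
      moreover have "card (f x - {fst x}) = 2" using F3[OF fx(1)] fx(2) by simp
      then obtain z where "z \<in> f x - {fst x}" by (metis all_not_in_conv card.empty zero_neq_numeral)
      ultimately have "z \<in> cls C (snd x)" "z \<in> cls C (snd y)" using fx(3) by blast+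
      then have "snd x = snd y" by (simp add: cls_def)
      then show "x = y" using xy(3) by (simp add: prod_eq_iff)
    qed
    moreover have "(\<lambda>vk. (f vk, fst vk)) ` R \<subseteq> (SIGMA e:F. e)" using f by auto
    moreover have "finite (SIGMA e:F. e)" using finF F3 by auto
    ultimately have "card R \<le> card (SIGMA e:F. e)" by (metis card_image card_mono)
    also have "\<dots> = (\<Sum>e\<in>F. card e)" using finF F3 by simp
    also have "\<dots> = 3 * card F" using F3 by simp
    finally have "card R \<le> 3 * card F" .
    moreover have "16 * r \<le> card (blocked E q c v \<inter> small C)" if "v \<in> S" for v
    proof -
      have "24 * r \<le> card (blocked E q c v)" using S that by auto
      also have "\<dots> \<le> card (blocked E q c v \<inter> small C \<union> big)"
        by (intro card_mono) (auto simp: big_def blocked_def)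
      also have "\<dots> \<le> card (blocked E q c v \<inter> small C) + card big" by (rule card_Un_le)
      finally show ?thesis using big by linarith
    qed
    then have "of_nat (card S) * (16 * r) \<le> (\<Sum>v\<in>S. card (blocked E q c v \<inter> small C))"
      by (intro sum_bounded_below)
    then have "s * (16 * r) \<le> card R" using S by (simp add: R_def)
    moreover have "0 \<le> r * s" by simp
    \<comment> \<open>The count is \<open>16 * r * s\<close> pairs at three per edge, with 16/3
      rounded down to 5.\<close>
    ultimately have "5 * (r * s) \<le> card F" by (simp add: algebra_simps)
    then show "\<exists>i\<in>I. E \<in> {E. 5 * (r * s) \<le> card (E \<inter> T i)}"
      using C S by (intro bexI[of _ "(C, S)"]) (auto simp: I_def F_def)
  qed
  also have "\<dots> \<le> (2 * (real q + 1)) ^ n * (exp 1 / \<theta>) ^ (5 * (r * s))"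
  proof (intro mult_right_mono)
    have "card ({1..n} \<rightarrow>\<^sub>E {0..q}) = (q + 1) ^ n" by (simp add: card_PiE)
    then have "card I = (q + 1) ^ n * (n choose s)"
      unfolding I_def card_cartesian_product card_subsets_of_card by simp
    also have "\<dots> \<le> (q + 1) ^ n * 2 ^ n" by (intro mult_left_mono binomial_le_pow2) auto
    also have "\<dots> = (2 * (q + 1)) ^ n" by (simp only: power_mult_distrib mult.commute)
    finally have "card I \<le> (2 * (q + 1)) ^ n" .
    then have "real (card I) \<le> real ((2 * (q + 1)) ^ n)" by (rule of_nat_mono)
    then show "real (card I) \<le> (2 * (real q + 1)) ^ n"
      by (simp only: of_nat_power of_nat_mult of_nat_add of_nat_numeral of_nat_1)
  qed (use \<theta> in simp)
  also have "exp 1 / \<theta> = exp 1 * d / (40 * real r ^ 2)" by (simp add: \<theta>_def)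
  finally show ?thesis .
qed

text \<open>A vertex of an overlap lies in \<open>S\<close>, which costs an internal edge, or it
  belongs to the set \<open>X\<close> of outside vertices with two neighbors in \<open>S\<close>. If
  \<open>X\<close> had \<open>3 * h * s\<close> elements, a subset of exactly that size would
  contradict \<open>pair\<close>; so \<open>X\<close> is smaller, and padding it to that size bounds
  its adjacencies. The two halves are \<open>6 * h * s\<close> each.\<close>

lemma overlap_sum_less:
  assumes E: "E \<subseteq> uniform_edges 3 n" and S: "S \<subseteq> {1..n}" "card S = s" and n: "(3 * h + 1) * s \<le> n"
    and internal: "card {e \<in> E. 2 \<le> card (e \<inter> S)} < h * s"
    and pair: "\<And>X. X \<subseteq> {1..n} - S \<Longrightarrow> card X = 3 * h * s \<Longrightarrow>
      (\<Sum>e\<in>E. card (e \<inter> S) * card (e \<inter> X)) < 2 * (3 * h * s)"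
  shows "(\<Sum>v\<in>S. card (overlap E v S)) < 4 * (3 * h * s)"
proof -
  have finS: "finite S" using S finite_subset by blast
  have finE: "finite E" using E finite_subset finite_uniform_edges by blast
  have E3: "finite e" "card e = 3" "e \<subseteq> {1..n}" if "e \<in> E" for e
    using uniform_edges_3D that E by blast+
  have nb: "nbrs E v \<subseteq> {1..n}" for v using E3 by (auto simp: nbrs_def)
  then have finN [simp]: "finite (nbrs E v)" for v using finite_subset by blast
  define X where "X = {x \<in> {1..n} - S. 2 \<le> card (nbrs E x \<inter> S)}"
  have "card (overlap E v S) \<le> card (nbrs E v \<inter> S) + card (nbrs E v \<inter> X)" if v: "v \<in> S" for v
  proof -
    have "overlap E v S \<subseteq> (nbrs E v \<inter> S) \<union> (nbrs E v \<inter> X)"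
    proof
      fix x assume x: "x \<in> overlap E v S"
      then have xv: "x \<in> nbrs E v" by (simp add: overlap_def)
      show "x \<in> (nbrs E v \<inter> S) \<union> (nbrs E v \<inter> X)"
      proof (cases "x \<in> S")
        case False
        then obtain u where u: "u \<in> S" "u \<noteq> v" "x \<in> nbrs E u" using x by (auto simp: overlap_def)
        have "{u, v} \<subseteq> nbrs E x \<inter> S" using u v nbrs_sym[OF xv] nbrs_sym[OF u(3)] by auto
        then have "card {u, v} \<le> card (nbrs E x \<inter> S)" by (intro card_mono) auto
        moreover have "x \<in> {1..n}" using xv nb by blast
        ultimately show ?thesis using u(2) False xv by (auto simp: X_def)
      qed (use xv in auto)
    qed
    then have "card (overlap E v S) \<le> card ((nbrs E v \<inter> S) \<union> (nbrs E v \<inter> X))"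
      by (intro card_mono) auto
    then show ?thesis using card_Un_le le_trans by blast
  qed
  then have "(\<Sum>v\<in>S. card (overlap E v S))
      \<le> (\<Sum>v\<in>S. card (nbrs E v \<inter> S) + card (nbrs E v \<inter> X))" by (rule sum_mono)
  also have "\<dots> = (\<Sum>v\<in>S. card (nbrs E v \<inter> S)) + (\<Sum>v\<in>S. card (nbrs E v \<inter> X))"
    by (rule sum.distrib)
  also have "(\<Sum>v\<in>S. card (nbrs E v \<inter> S)) \<le> 6 * card {e \<in> E. 2 \<le> card (e \<inter> S)}"
  proof -
    have "(\<Sum>v\<in>S. card (nbrs E v \<inter> S)) = card (SIGMA v:S. nbrs E v \<inter> S)" using finS by simp
    also have "\<dots> \<le> 6 * card {e \<in> E. 2 \<le> card (e \<inter> S)}"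
    proof (rule card_adjacent_pairs_le)
      fix v x assume "(v, x) \<in> (SIGMA v:S. nbrs E v \<inter> S)"
      then obtain e where e: "v \<in> S" "x \<in> S" "x \<noteq> v" "e \<in> E" "v \<in> e" "x \<in> e" by (auto simp: nbrs_def)
      have "card {v, x} \<le> card (e \<inter> S)" using e E3 by (intro card_mono) auto
      then show "v \<noteq> x \<and> (\<exists>e\<in>{e \<in> E. 2 \<le> card (e \<inter> S)}. v \<in> e \<and> x \<in> e)" using e by auto
    qed (use finE E3 in auto)
    finally show ?thesis .
  qed
  also have "6 * card {e \<in> E. 2 \<le> card (e \<inter> S)} + (\<Sum>v\<in>S. card (nbrs E v \<inter> X)) < 4 * (3 * h * s)"
  proof -
    have pairs: "(\<Sum>x\<in>Y. card (nbrs E x \<inter> S)) < 2 * (3 * h * s)"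
      if Y: "Y \<subseteq> {1..n} - S" "card Y = 3 * h * s" for Y
    proof -
      have finY: "finite Y" using Y finite_subset by blast
      have "(\<Sum>x\<in>Y. card (nbrs E x \<inter> S)) = card (SIGMA x:Y. nbrs E x \<inter> S)" using finY by simp
      also have "\<dots> \<le> card (\<Union>e\<in>E. (e \<inter> Y) \<times> (e \<inter> S))"
        using finE E3 by (intro card_mono) (auto simp: nbrs_def)
      also have "\<dots> \<le> (\<Sum>e\<in>E. card ((e \<inter> Y) \<times> (e \<inter> S)))" using finE by (rule card_UN_le)
      also have "\<dots> = (\<Sum>e\<in>E. card (e \<inter> S) * card (e \<inter> Y))"
        by (simp add: card_cartesian_product mult.commute)
      finally show ?thesis using pair[OF Y] by linarith
    qed
    have "(\<Sum>v\<in>S. card (nbrs E v \<inter> X)) = card (SIGMA v:S. nbrs E v \<inter> X)" using finS by simp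
    also have "\<dots> = card ((\<lambda>(v, x). (x, v)) ` (SIGMA v:S. nbrs E v \<inter> X))"
      by (intro card_image[symmetric]) (auto intro: inj_onI)
    also have "(\<lambda>(v, x). (x, v)) ` (SIGMA v:S. nbrs E v \<inter> X) = (SIGMA x:X. nbrs E x \<inter> S)"
      by (force dest: nbrs_sym)
    also have "card \<dots> = (\<Sum>x\<in>X. card (nbrs E x \<inter> S))" by (simp add: X_def)
    also have "\<dots> < 2 * (3 * h * s)"
    proof (cases "3 * h * s \<le> card X")
      case True
      then obtain Y where Y: "Y \<subseteq> X" "card Y = 3 * h * s" "finite Y" by (rule obtain_subset_with_card_n)
      have "of_nat (card Y) * 2 \<le> (\<Sum>x\<in>Y. card (nbrs E x \<inter> S))"
        using Y by (intro sum_bounded_below) (auto simp: X_def)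
      then have "2 * (3 * h * s) \<le> (\<Sum>x\<in>Y. card (nbrs E x \<inter> S))" using Y by simp
      moreover have "Y \<subseteq> {1..n} - S" using Y by (auto simp: X_def)
      ultimately show ?thesis using pairs[of Y] Y(2) by linarith
    next
      case False
      have "card ({1..n} - S) = n - s" using S finS by (simp add: card_Diff_subset)
      moreover have "X \<subseteq> {1..n} - S" by (auto simp: X_def)
      moreover have "3 * h * s \<le> n - s" using n by (simp add: algebra_simps)
      ultimately obtain Y where Y: "X \<subseteq> Y" "Y \<subseteq> {1..n} - S" "card Y = 3 * h * s"
        using exists_subset_between[of X "3 * h * s" "{1..n} - S"] False by auto
      have "(\<Sum>x\<in>X. card (nbrs E x \<inter> S)) \<le> (\<Sum>x\<in>Y. card (nbrs E x \<inter> S))"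
        using Y finite_subset[OF Y(2)] by (intro sum_mono2) auto
      then show ?thesis using pairs[OF Y(2,3)] by linarith
    qed
    finally show ?thesis using internal by linarith
  qed
  finally show ?thesis by simp
qed

end

section \<open>The parameters and the total failure probability\<close>

lemma tail_term_le:
  fixes \<kappa> z :: real
  assumes "0 < z" "0 \<le> \<kappa>" "\<kappa> * z \<le> 1 / 4" "exp 1 * \<kappa>\<^sup>2 \<le> 4 ^ (k - 2)" "2 \<le> k"
  shows "exp 1 / z * (\<kappa> * z) ^ k \<le> z"
proof -
  obtain l where k: "k = 2 + l" using assms(5) le_Suc_ex by blast
  \<comment> \<open>Two of the \<open>k\<close> factors turn \<open>1 / z\<close> into
    \<open>z\<close>; the remaining ones are at most 1/4 each and pay for the constant.\<close>
  have "exp 1 / z * (\<kappa> * z) ^ k = exp 1 * \<kappa>\<^sup>2 * z * (\<kappa> * z) ^ l"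
    using assms(1) by (simp add: k power_add power2_eq_square)
  also have "\<dots> \<le> 4 ^ l * z * (1 / 4) ^ l"
    using assms k by (intro mult_mono power_mono mult_nonneg_nonneg) auto
  also have "\<dots> = z" by (simp add: power_one_over)
  finally show ?thesis .
qed

text \<open>\<open>\<beta>\<close> is the unit of comparison: a coloring of all vertices together
  with a choice of endangered ones costs at most \<open>\<beta> ^ 4\<close> per vertex, and by
  \<open>r2\<close> every edge demanded in the first two failure events gains
  \<open>1 / \<beta>\<close>. \<open>\<kappa>\<close> is the base of the bound for dense pairs, so
  \<open>\<kappa>_le\<close> is the condition that \<open>r^3\<close> exceeds a multiple of
  \<open>d^2\<close>.\<close>

context
  fixes n q h r m\<^sub>1 m\<^sub>2 L w :: nat and d \<beta> p \<kappa> :: real and M :: "nat set set pmf"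
  assumes d_eq: "d = \<beta> ^ 4" and \<beta>: "2 \<le> \<beta>"
    and r_eq: "r = 3 * h" and r_large: "1000 \<le> r" and q_ge: "64 * r \<le> q" and q_le: "2 * (real q + 1) \<le> d"
    and r2: "7 * exp 1 * d * \<beta> \<le> (real r)\<^sup>2"
    and \<kappa>_eq: "\<kappa> = exp 1 ^ 3 * d\<^sup>2 / real r" and \<kappa>_le: "800 * \<kappa> \<le> (real r)\<^sup>2"
    and \<kappa>_exp: "exp 1 * \<kappa>\<^sup>2 \<le> 4 ^ (h - 2)"
    and n_ge: "r \<le> n" "d \<le> real n ^ 2" and p_eq: "p = d / real n ^ 2"
  defines "M \<equiv> random_hypergraph 3 n p"
    and "m\<^sub>1 \<equiv> 2 * n div r" and "m\<^sub>2 \<equiv> 100 * n div r ^ 2" and "L \<equiv> 2 * m\<^sub>2"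
    and "w \<equiv> 2 * (L + m\<^sub>1) + 2"
begin

lemma parameter_bounds: "0 < n" "0 < r" "0 < d" "p \<le> 1" "16 \<le> d" "exp 1 \<le> d" "real r + 1 \<le> d" "2 \<le> h"
proof -
  show "0 < n" "0 < r" "2 \<le> h" using r_large n_ge r_eq by auto
  have "2 ^ 4 \<le> \<beta> ^ 4" using \<beta> by (intro power_mono) auto
  then show "16 \<le> d" by (simp add: d_eq)
  then show "0 < d" by simp
  then show "p \<le> 1" using n_ge by (auto simp: p_eq divide_le_eq_1)
  show "exp 1 \<le> d" using exp_le \<open>16 \<le> d\<close> by simp
  have "real r \<le> real q" using q_ge by simp
  then show "real r + 1 \<le> d" using q_le by simp
qed

text \<open>With \<open>\<kappa>\<close> dominating the other bases that occur, the conditions on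
  \<open>\<kappa>\<close> also serve for internal edges and for the side condition
  \<open>s * d \<le> n\<close>.\<close>

lemma \<kappa>_ge: "d \<le> \<kappa>" "exp 1 * d / real h \<le> \<kappa>"
proof -
  have e: "1 \<le> exp (1::real)" by simp
  have "d * real r \<le> d * d" using parameter_bounds by (intro mult_left_mono) auto
  also have "\<dots> \<le> exp 1 ^ 3 * (d * d)"
    using mult_right_mono[OF one_le_power[OF e, of 3], of "d * d"] parameter_bounds by simp
  finally show "d \<le> \<kappa>" using parameter_bounds by (simp add: \<kappa>_eq field_simps power2_eq_square)
  have "3 * exp 1 \<le> exp 1 ^ 3 * d"
  proof -
    have "exp 1 * 3 \<le> exp 1 * (exp 1 ^ 2 * d)"
      using mult_mono[OF one_le_power[OF e, of 2], of 3 d] parameter_bounds by (intro mult_left_mono) auto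
    then show ?thesis by (simp add: power3_eq_cube power2_eq_square mult_ac)
  qed
  then have "3 * exp 1 * d \<le> exp 1 ^ 3 * d * d" using parameter_bounds by (intro mult_right_mono) auto
  then show "exp 1 * d / real h \<le> \<kappa>"
    using parameter_bounds by (simp add: \<kappa>_eq r_eq field_simps power2_eq_square)
qed

lemma m2_bounds: "real r ^ 2 * real m\<^sub>2 \<le> 100 * real n" "real r * real m\<^sub>2 \<le> real n / 10"
proof -
  have "r ^ 2 * m\<^sub>2 \<le> 100 * n" by (simp add: m\<^sub>2_def)
  then show *: "real r ^ 2 * real m\<^sub>2 \<le> 100 * real n"
    by (metis of_nat_mono of_nat_mult of_nat_numeral of_nat_power)
  have "1000 * (real r * real m\<^sub>2) \<le> real r * (real r * real m\<^sub>2)"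
    using r_large by (intro mult_right_mono) auto
  then show "real r * real m\<^sub>2 \<le> real n / 10" using * by (simp add: power2_eq_square mult.assoc)
qed

text \<open>Multiplied by \<open>r\<close>, the parts of \<open>w\<close> from \<open>L\<close>,
  from \<open>m\<^sub>1\<close> and from the constant are at most 0.4, 4 and 2 times
  \<open>n\<close>; the 7 is their sum rounded up.\<close>

lemma stage_length_le: "real w * real r \<le> 7 * real n" "w \<le> n"
proof -
  have "r * m\<^sub>1 \<le> 2 * n" by (simp add: m\<^sub>1_def)
  then have "real r * real m\<^sub>1 \<le> 2 * real n" by (metis of_nat_mono of_nat_mult of_nat_numeral)
  moreover have "real r \<le> real n" using n_ge by simp
  moreover have "real w * real r = 4 * (real r * real m\<^sub>2) + 2 * (real r * real m\<^sub>1) + 2 * real r"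
    by (simp add: w_def L_def algebra_simps)
  ultimately show *: "real w * real r \<le> 7 * real n" using m2_bounds(2) by linarith
  have "real w * 7 \<le> real w * real r" using r_large by (intro mult_left_mono) auto
  then show "w \<le> n" using * by simp
qed

text \<open>The choices cost \<open>d ^ n = \<beta> ^ (4 * n)\<close>. The 2 in
  \<open>m\<^sub>1\<close> forces at least \<open>10 * n\<close> edges, each gaining
  \<open>1 / \<beta>\<close>.\<close>

lemma prob_endangered_le:
  "measure_pmf.prob M {E. \<exists>c. m\<^sub>1 + 1 \<le> card {v \<in> {1..n}. 24 * r \<le> card (blocked E q c v)}}
    \<le> (1 / 2) ^ n"
proof -
  have "7 * (exp 1 * d * \<beta>) \<le> real r ^ 2" using r2 by (simp add: mult.assoc)
  moreover have "1 * d * 1 \<le> exp 1 * d * \<beta>" using parameter_bounds \<beta> by (intro mult_mono) auto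
  ultimately have d_le: "exp 1 * d * \<beta> \<le> 40 * real r ^ 2" "d \<le> 40 * real r ^ 2"
    using parameter_bounds(3) by linarith+
  have *: "exp 1 * d / (40 * real r ^ 2) \<le> 1 / \<beta>"
    using d_le(1) parameter_bounds(2) \<beta> by (simp add: divide_le_eq pos_le_divide_eq mult.commute)
  have "measure_pmf.prob M {E. \<exists>c. m\<^sub>1 + 1 \<le> card {v \<in> {1..n}. 24 * r \<le> card (blocked E q c v)}}
      \<le> (2 * (real q + 1)) ^ n * (exp 1 * d / (40 * real r ^ 2)) ^ (5 * (r * (m\<^sub>1 + 1)))"
    unfolding M_def by (rule prob_many_endangered[OF parameter_bounds(1,3) p_eq parameter_bounds(4,2) d_le(2)])
  also have "\<dots> \<le> d ^ n * (1 / \<beta>) ^ (5 * (r * (m\<^sub>1 + 1)))"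
    using q_le * parameter_bounds by (intro mult_mono power_mono) auto
  also have "\<dots> \<le> d ^ n * (1 / \<beta>) ^ (10 * n)"
  proof (intro mult_left_mono power_decreasing)
    have "2 * n \<le> r * (m\<^sub>1 + 1)"
      using dividend_less_times_div[of r "2 * n"] parameter_bounds unfolding m\<^sub>1_def by simp
    then show "10 * n \<le> 5 * (r * (m\<^sub>1 + 1))" by simp
  qed (use \<beta> parameter_bounds in auto)
  also have "\<dots> = (1 / \<beta> ^ 6) ^ n"
  proof -
    have "\<beta> ^ 4 * (1 / \<beta>) ^ 10 = 1 / \<beta> ^ 6" using \<beta> by (simp add: field_simps flip: power_add)
    then show ?thesis by (simp add: d_eq power_mult flip: power_mult_distrib)
  qed
  also have "\<dots> \<le> (1 / 2) ^ n"
  proof (intro power_mono)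
    have "2 \<le> \<beta> ^ 1" using \<beta> by simp
    also have "\<dots> \<le> \<beta> ^ 6" using \<beta> by (intro power_increasing) auto
    finally show "1 / \<beta> ^ 6 \<le> 1 / 2" by (intro divide_left_mono) auto
  qed (use \<beta> in auto)
  finally show ?thesis .
qed

text \<open>As exponents of \<open>\<beta>\<close> in units of \<open>n / r\<close>, the choices
  cost at most \<open>28 + 8\<close> units plus \<open>4 * s\<close>, while the edges gain
  \<open>r * s\<close>, at least 100 units by the definition of \<open>m\<^sub>2\<close>. With a
  gain of this order only sets of size \<open>O(n / r)\<close> can be afforded, which is why the
  stage must be short.\<close>

lemma prob_attacked_le:
  "measure_pmf.prob M {E. \<exists>W\<subseteq>{1..n}. card W \<le> w \<and>
      m\<^sub>2 + 1 \<le> card {v \<in> {1..n}. 8 * r \<le> card (nbrs E v \<inter> W)}} \<le> 2 powr (- (real n / real r))"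
proof -
  define s where "s = m\<^sub>2 + 1"
  have *: "7 * exp 1 * d / real r ^ 2 \<le> 1 / \<beta>"
    using r2 parameter_bounds(2) \<beta> by (simp add: divide_le_eq pos_le_divide_eq mult.commute)
  have "exp 1 * d * \<beta> \<ge> 1 * d * 1" using parameter_bounds \<beta> by (intro mult_mono) auto
  then have d_le: "7 * d \<le> real r ^ 2" using r2 by (simp add: mult.assoc)
  have bin: "real (n choose k) \<le> \<beta> powr (4 * real k + 4 * (real n / real r))" for k
  proof -
    have "real (n choose k) \<le> real r ^ k * exp (real n / real r)"
      using parameter_bounds by (intro binomial_le_power_exp) auto
    also have "\<dots> \<le> d ^ k * d powr (real n / real r)"
    proof (intro mult_mono power_mono)
      have "exp (real n / real r) = exp 1 powr (real n / real r)" by (simp add: powr_def)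
      also have "\<dots> \<le> d powr (real n / real r)" using parameter_bounds by (intro powr_mono2) auto
      finally show "exp (real n / real r) \<le> d powr (real n / real r)" .
    qed (use parameter_bounds in auto)
    also have "\<dots> = d powr real k * d powr (real n / real r)" using parameter_bounds by (simp add: powr_realpow)
    also have "\<dots> = d powr (real k + real n / real r)" by (simp add: powr_add)
    also have "d = \<beta> powr 4" using \<beta> by (simp add: d_eq)
    finally show ?thesis by (simp add: powr_powr algebra_simps)
  qed
  have rs: "real r * (real r * real s) \<ge> 100 * real n"
  proof -
    have "100 * n \<le> r ^ 2 * s"
      using dividend_less_times_div[of "r ^ 2" "100 * n"] parameter_bounds unfolding s_def m\<^sub>2_def by simp
    then have "real (100 * n) \<le> real (r ^ 2 * s)" by (rule of_nat_mono)
    then show ?thesis by (simp add: power2_eq_square algebra_simps)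
  qed
  have "measure_pmf.prob M {E. \<exists>W\<subseteq>{1..n}. card W \<le> w \<and>
      s \<le> card {v \<in> {1..n}. 8 * r \<le> card (nbrs E v \<inter> W)}}
    \<le> real (n choose w) * real (n choose s) * (7 * exp 1 * d / real r ^ 2) ^ (r * s)"
    unfolding M_def by (rule prob_many_attacked[OF parameter_bounds(1,3) p_eq parameter_bounds(4,2) d_le stage_length_le(2,1)])
  also have "\<dots> \<le> \<beta> powr (4 * real w + 4 * (real n / real r))
      * \<beta> powr (4 * real s + 4 * (real n / real r)) * (1 / \<beta>) ^ (r * s)"
    using bin * parameter_bounds by (intro mult_mono power_mono) auto
  also have "(1 / \<beta>) ^ (r * s) = \<beta> powr (- (real r * real s))"
    using \<beta> by (simp add: power_one_over powr_minus field_simps flip: powr_realpow)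
  also have "\<beta> powr (4 * real w + 4 * (real n / real r))
      * \<beta> powr (4 * real s + 4 * (real n / real r)) * \<beta> powr (- (real r * real s))
    = \<beta> powr (4 * real w + 8 * (real n / real r) + 4 * real s - real r * real s)"
    by (simp add: algebra_simps flip: powr_add)
  also have "\<dots> \<le> \<beta> powr (- (real n / real r))"
  proof (rule powr_mono)
    have "real w \<le> 7 * (real n / real r)" using stage_length_le(1) parameter_bounds by (simp add: field_simps)
    moreover have "100 * (real n / real r) \<le> real r * real s" using rs parameter_bounds by (simp add: field_simps)
    moreover have "1000 * real s \<le> real r * real s" using r_large by (intro mult_right_mono) auto
    moreover have "0 \<le> real r * real s" by simp
    ultimately show "4 * real w + 8 * (real n / real r) + 4 * real s - real r * real s
        \<le> - (real n / real r)" by linarith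
  qed (use \<beta> in simp)
  also have "\<dots> \<le> 2 powr (- (real n / real r))" using \<beta> by (intro powr_mono2') auto
  finally show ?thesis by (simp add: s_def)
qed

text \<open>For \<open>z = s / n\<close> the cap \<open>L\<close> gives
  \<open>r^2 * z \<le> 200\<close>, and \<open>800 * \<kappa> \<le> r^2\<close> turns this into
  \<open>\<kappa> * z \<le> 1 / 4\<close>. Everything is then collected into a single
  \<open>s\<close>-th power, to which \<open>tail_term_le\<close> applies.\<close>

lemma prob_overlaps_le:
  assumes s: "1 \<le> s" "s \<le> L"
  shows "measure_pmf.prob M {E. \<exists>S\<subseteq>{1..n}. card S = s \<and> h * s \<le> card {e \<in> E. 2 \<le> card (e \<inter> S)}}
      \<le> (real s / real n) ^ s" (is ?A)
    and "measure_pmf.prob M {E. \<exists>S\<subseteq>{1..n}. \<exists>X\<subseteq>{1..n} - S. card S = s \<and> card X = r * s \<and>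
      2 * (r * s) \<le> (\<Sum>e\<in>E. card (e \<inter> S) * card (e \<inter> X))} \<le> (real s / real n) ^ s" (is ?B)
proof -
  define z where "z = real s / real n"
  have z: "0 < z" using s parameter_bounds by (simp add: z_def)
  have "real s \<le> 2 * real m\<^sub>2" using s(2) unfolding L_def by simp
  then have "(real r)\<^sup>2 * real s \<le> (real r)\<^sup>2 * (2 * real m\<^sub>2)" by (intro mult_left_mono) auto
  then have "(real r)\<^sup>2 * real s \<le> 200 * real n" using m2_bounds(1) by simp
  then have rz: "(real r)\<^sup>2 * z \<le> 200" using parameter_bounds by (simp add: z_def field_simps)
  have "800 * \<kappa> * z \<le> (real r)\<^sup>2 * z" using \<kappa>_le z by (intro mult_right_mono) auto
  then have \<kappa>z: "\<kappa> * z \<le> 1 / 4" using rz by simp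
  have "d * z \<le> \<kappa> * z" using \<kappa>_ge z by (intro mult_right_mono) auto
  then have "d * z \<le> 1" using \<kappa>z by simp
  then have sd: "real s * d \<le> real n" using parameter_bounds by (simp add: z_def field_simps)
  also have "\<dots> \<le> real h * real n" using parameter_bounds by (simp add: mult_le_cancel_right1)
  finally have sdh: "real s * d \<le> real h * real n" .
  have s0: "0 < s" using s by simp
  have bin: "real (n choose s) \<le> (exp 1 / z) ^ s"
    using binomial_le_exp_power[of s n] s0 parameter_bounds by (simp add: z_def)
  have k1: "exp 1 * d / real h * z \<le> 1 / 4"
    using mult_right_mono[OF \<kappa>_ge(2), of z] z \<kappa>z by linarith
  have k2: "exp 1 * (exp 1 * d / real h)\<^sup>2 \<le> 4 ^ (h - 2)"
  proof -
    have "(exp 1 * d / real h)\<^sup>2 \<le> \<kappa>\<^sup>2" using \<kappa>_ge(2) parameter_bounds by (intro power_mono) auto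
    then have "exp 1 * (exp 1 * d / real h)\<^sup>2 \<le> exp 1 * \<kappa>\<^sup>2" by simp
    then show ?thesis using \<kappa>_exp by linarith
  qed
  have "measure_pmf.prob M {E. \<exists>S\<subseteq>{1..n}. card S = s \<and> h * s \<le> card {e \<in> E. 2 \<le> card (e \<inter> S)}}
      \<le> real (n choose s) * (exp 1 * real s * d / (real h * real n)) ^ (h * s)"
    unfolding M_def by (rule prob_many_internal_edges[OF parameter_bounds(1,3) p_eq parameter_bounds(4) s0 sdh])
  also have "exp 1 * real s * d / (real h * real n) = exp 1 * d / real h * z"
    by (simp add: z_def)
  also have "real (n choose s) * (exp 1 * d / real h * z) ^ (h * s)
      \<le> (exp 1 / z) ^ s * (exp 1 * d / real h * z) ^ (h * s)"
    using bin z parameter_bounds by (intro mult_right_mono) auto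
  also have "\<dots> = (exp 1 / z * (exp 1 * d / real h * z) ^ h) ^ s"
    by (simp only: power_mult power_mult_distrib mult.assoc)
  also have "\<dots> \<le> z ^ s"
    using tail_term_le[OF z _ k1 k2 parameter_bounds(8)] z parameter_bounds by (intro power_mono) auto
  finally show ?A by (simp add: z_def)
  have kr: "exp 1 * \<kappa>\<^sup>2 \<le> 4 ^ (r - 2)"
  proof -
    have "(4::real) ^ (h - 2) \<le> 4 ^ (r - 2)" using r_eq by (intro power_increasing) auto
    then show ?thesis using \<kappa>_exp by linarith
  qed
  have binr: "real (n choose (r * s)) \<le> (exp 1 / (real r * z)) ^ (r * s)"
    using binomial_le_exp_power[of "r * s" n] s0 parameter_bounds by (simp add: z_def)
  have "measure_pmf.prob M {E. \<exists>S\<subseteq>{1..n}. \<exists>X\<subseteq>{1..n} - S. card S = s \<and> card X = r * s \<and>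
      2 * (r * s) \<le> (\<Sum>e\<in>E. card (e \<inter> S) * card (e \<inter> X))}
      \<le> real (n choose s) * real (n choose (r * s)) * (exp 1 * real s * d / real n) ^ (2 * (r * s))"
    unfolding M_def by (rule prob_dense_pair[OF parameter_bounds(1,3) p_eq parameter_bounds(4) s0 sd parameter_bounds(7)])
  also have "exp 1 * real s * d / real n = exp 1 * d * z" by (simp add: z_def)
  also have "real (n choose s) * real (n choose (r * s)) * (exp 1 * d * z) ^ (2 * (r * s))
      \<le> (exp 1 / z) ^ s * (exp 1 / (real r * z)) ^ (r * s) * (exp 1 * d * z) ^ (2 * (r * s))"
    using bin binr z parameter_bounds by (intro mult_right_mono mult_mono) auto
  also have "\<dots> = (exp 1 / z * (exp 1 / (real r * z) * (exp 1 * d * z)\<^sup>2) ^ r) ^ s"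
    by (simp only: power_mult power_mult_distrib mult.assoc)
  \<comment> \<open>The choice of \<open>X\<close> cancels one of the two factors \<open>z\<close>
    contributed by the two neighbors that each vertex of \<open>X\<close> has in
    \<open>S\<close>.\<close>
  also have "exp 1 / (real r * z) * (exp 1 * d * z)\<^sup>2 = \<kappa> * z"
    using z parameter_bounds by (simp add: \<kappa>_eq power2_eq_square power3_eq_cube field_simps)
  also have "(exp 1 / z * (\<kappa> * z) ^ r) ^ s \<le> z ^ s"
  proof (rule power_mono)
    show "exp 1 / z * (\<kappa> * z) ^ r \<le> z"
      using \<kappa>_ge(1) parameter_bounds r_large by (intro tail_term_le z \<kappa>z kr) auto
    show "0 \<le> exp 1 / z * (\<kappa> * z) ^ r" using z \<kappa>_ge(1) parameter_bounds by auto
  qed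
  finally show ?B by (simp add: z_def)
qed

lemma prob_A_loses_le:
  "measure_pmf.prob M {E. \<not> (\<exists>\<sigma>. winning_strategy_A {1..n} E q \<sigma>)}
    \<le> (1 / 2) ^ n + 2 powr (- (real n / real r)) + 4 / real n"
proof -
  define F1 where "F1 = {E. \<exists>c. m\<^sub>1 + 1 \<le> card {v \<in> {1..n}. 24 * r \<le> card (blocked E q c v)}}"
  define F2 where "F2 = {E. \<exists>W\<subseteq>{1..n}. card W \<le> w \<and>
      m\<^sub>2 + 1 \<le> card {v \<in> {1..n}. 8 * r \<le> card (nbrs E v \<inter> W)}}"
  define F3 where "F3 s = {E. \<exists>S\<subseteq>{1..n}. card S = s \<and> h * s \<le> card {e \<in> E. 2 \<le> card (e \<inter> S)}}" for s
  define F4 where "F4 s = {E. \<exists>S\<subseteq>{1..n}. \<exists>X\<subseteq>{1..n} - S. card S = s \<and> card X = r * s \<and>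
      2 * (r * s) \<le> (\<Sum>e\<in>E. card (e \<inter> S) * card (e \<inter> X))}" for s
  let ?P = "measure_pmf.prob M"
  have L: "4 * L \<le> n" "2 * (r * L) \<le> n"
  proof -
    have "2 * (real r * real L) \<le> real n" using m2_bounds(2) by (simp add: L_def)
    then show *: "2 * (r * L) \<le> n" by (metis of_nat_le_iff of_nat_mult of_nat_numeral)
    have "2 * L \<le> r * L" using r_large by (intro mult_right_mono) auto
    then show "4 * L \<le> n" using * by linarith
  qed
  have win: "\<exists>\<sigma>. winning_strategy_A {1..n} E q \<sigma>"
    if E: "E \<in> set_pmf M" and good: "E \<notin> F1" "E \<notin> F2" "\<And>s. s \<in> {1..L} \<Longrightarrow> E \<notin> F3 s \<union> F4 s" for E
  proof -
    have EU: "E \<subseteq> uniform_edges 3 n"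
      using edges_in_support(2)[OF parameter_bounds(1,3) p_eq parameter_bounds(4)] E unfolding M_def by blast
    \<comment> \<open>The budget \<open>24 * r + 8 * r + 2 * (8 * r)\<close> is
      \<open>48 * r\<close>, so \<open>q \<ge> 64 * r\<close> covers it with room for the
      constant.\<close>
    interpret guarded_game "{1..n}" E q "24 * r" "8 * r" "8 * r" L m\<^sub>1 m\<^sub>2
    proof
      show "e \<subseteq> {1..n} \<and> 2 \<le> card e" if "e \<in> E" for e
        using that EU by (auto simp: uniform_edges_def)
      show "card {v \<in> {1..n}. 24 * r \<le> card (blocked E q c v)} \<le> m\<^sub>1" for c
      proof (rule ccontr)
        assume "\<not> ?thesis"
        then have "E \<in> F1" unfolding F1_def by (intro CollectI exI[of _ c]) simp
        then show False using good(1) by simp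
      qed
      show "card {v \<in> {1..n}. 8 * r \<le> card (nbrs E v \<inter> W)} \<le> m\<^sub>2"
        if "W \<subseteq> {1..n}" "card W \<le> 2 * (L + m\<^sub>1) + 2" for W
      proof (rule ccontr)
        assume "\<not> ?thesis"
        then have "E \<in> F2" unfolding F2_def w_def by (intro CollectI exI[of _ W] conjI that) simp
        then show False using good(2) by simp
      qed
      show "2 * (\<Sum>v\<in>S. card (overlap E v S)) < 8 * r * card S"
        if S: "S \<subseteq> {1..n}" "S \<noteq> {}" "card S \<le> L" for S
      proof -
        have fS: "finite S" using S finite_subset by blast
        then have s: "card S \<in> {1..L}" using S by (simp add: Suc_le_eq card_gt_0_iff)
        note g = good(3)[OF s]
        have "(\<Sum>v\<in>S. card (overlap E v S)) < 4 * (3 * h * card S)"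
        proof (rule overlap_sum_less[OF parameter_bounds(1,3) p_eq parameter_bounds(4) EU S(1) refl])
          have "(3 * h + 1) * card S \<le> (2 * r) * L"
            using S(3) r_large r_eq by (intro mult_le_mono) auto
          then show "(3 * h + 1) * card S \<le> n" using L(2) by simp
          show "card {e \<in> E. 2 \<le> card (e \<inter> S)} < h * card S"
          proof (rule ccontr)
            assume "\<not> ?thesis"
            then have "E \<in> F3 (card S)" unfolding F3_def by (intro CollectI exI[of _ S] conjI S(1) refl) simp
            then show False using g by simp
          qed
          show "(\<Sum>e\<in>E. card (e \<inter> S) * card (e \<inter> X)) < 2 * (3 * h * card S)"
            if X: "X \<subseteq> {1..n} - S" "card X = 3 * h * card S" for X
          proof (rule ccontr)
            assume "\<not> ?thesis"
            then have "E \<in> F4 (card S)" unfolding F4_def r_eq mem_Collect_eq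
              by (intro exI[of _ S] exI[of _ X] conjI S(1) X refl) simp
            then show False using g by simp
          qed
        qed
        \<comment> \<open>Here \<open>2 * 4 * 3 * h\<close> equals \<open>8 * r\<close>, which is
          why \<open>g\<close> is \<open>8 * r\<close>.\<close>
        then show ?thesis by (simp add: r_eq)
      qed
      show "24 * r + 8 * r + 2 * (8 * r) + 3 < q" using q_ge r_large by simp
    qed (use r_large in \<open>auto simp: L_def\<close>)
    show ?thesis by (rule A_wins)
  qed
  have "?P {E. \<not> (\<exists>\<sigma>. winning_strategy_A {1..n} E q \<sigma>)}
      = ?P ({E. \<not> (\<exists>\<sigma>. winning_strategy_A {1..n} E q \<sigma>)} \<inter> set_pmf M)"
    by (simp add: measure_Int_set_pmf)
  also have "\<dots> \<le> ?P (F1 \<union> F2 \<union> (\<Union>s\<in>{1..L}. F3 s \<union> F4 s))"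
  proof (intro measure_pmf.finite_measure_mono subsetI)
    fix E assume E: "E \<in> {E. \<not> (\<exists>\<sigma>. winning_strategy_A {1..n} E q \<sigma>)} \<inter> set_pmf M"
    show "E \<in> F1 \<union> F2 \<union> (\<Union>s\<in>{1..L}. F3 s \<union> F4 s)"
    proof (rule ccontr)
      assume "E \<notin> F1 \<union> F2 \<union> (\<Union>s\<in>{1..L}. F3 s \<union> F4 s)"
      then have "\<exists>\<sigma>. winning_strategy_A {1..n} E q \<sigma>" using E by (intro win) blast+
      then show False using E by blast
    qed
  qed simp
  also have "\<dots> \<le> ?P F1 + ?P F2 + ?P (\<Union>s\<in>{1..L}. F3 s \<union> F4 s)"
    using measure_Un_le[of "F1 \<union> F2" "measure_pmf M" "\<Union>s\<in>{1..L}. F3 s \<union> F4 s"]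
      measure_Un_le[of F1 "measure_pmf M" F2] by simp
  also have "?P (\<Union>s\<in>{1..L}. F3 s \<union> F4 s) \<le> (\<Sum>s=1..L. ?P (F3 s \<union> F4 s))"
    by (intro measure_pmf.finite_measure_subadditive_finite) auto
  also have "\<dots> \<le> (\<Sum>s=1..L. 2 * (real s / real n) ^ s)"
  proof (rule sum_mono)
    fix s assume s: "s \<in> {1..L}"
    have "?P (F3 s \<union> F4 s) \<le> ?P (F3 s) + ?P (F4 s)"
      by (rule measure_Un_le) auto
    moreover have "?P (F3 s) \<le> (real s / real n) ^ s" "?P (F4 s) \<le> (real s / real n) ^ s"
      unfolding F3_def F4_def using s prob_overlaps_le[of s] by auto
    ultimately show "?P (F3 s \<union> F4 s) \<le> 2 * (real s / real n) ^ s" by linarith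
  qed
  also have "\<dots> = 2 * (\<Sum>s=1..L. (real s / real n) ^ s)" by (simp add: sum_distrib_left)
  also have "\<dots> \<le> 2 * (2 / real n)" using sum_power_self_le[OF L(1) parameter_bounds(1)] by simp
  finally show ?thesis
    using prob_endangered_le prob_attacked_le by (simp add: F1_def F2_def)
qed

end

section \<open>Choosing the parameters for large d, and the limit in n\<close>

lemma eventually_parameters:
  fixes \<epsilon> :: real
  assumes \<epsilon>: "0 < \<epsilon>" "\<epsilon> \<le> 1 / 24"
  shows "\<forall>\<^sub>F d in at_top. \<exists>q h :: nat. real q \<le> d powr (2 / 3 + \<epsilon>) \<and> 192 * h \<le> q \<and> 1000 \<le> 3 * h \<and>
    16 \<le> d \<and> 2 * (real q + 1) \<le> d \<and> 7 * exp 1 * d * d powr (1 / 4) \<le> (real (3 * h))\<^sup>2 \<and>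
    800 * (exp 1 ^ 3 * d\<^sup>2 / real (3 * h)) \<le> (real (3 * h))\<^sup>2 \<and>
    exp 1 * (exp 1 ^ 3 * d\<^sup>2 / real (3 * h))\<^sup>2 \<le> 4 ^ (h - 2)"
proof -
  have "\<forall>\<^sub>F d :: real in at_top. 2 * (d powr (3 / 4) + 1) \<le> d" by real_asymp
  moreover have "\<forall>\<^sub>F d :: real in at_top. 7 * exp 1 * d * d powr (1 / 4) \<le> d powr (4 / 3)" by real_asymp
  moreover have "\<forall>\<^sub>F d :: real in at_top. exp 1 * (exp 1 ^ 3 * d\<^sup>2)\<^sup>2 \<le> 4 powr (d powr (2 / 3) - 2)"
    by real_asymp
  moreover have "\<forall>\<^sub>F d :: real in at_top. 1000 \<le> d powr (2 / 3)" by real_asymp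
  moreover have "\<forall>\<^sub>F d :: real in at_top. 800 * exp 1 ^ 3 \<le> d powr (\<epsilon> / 2)" using \<epsilon> by real_asymp
  moreover have "\<forall>\<^sub>F d :: real in at_top. 192 * (d powr (2 / 3 + \<epsilon> / 2) + 2) \<le> d powr (2 / 3 + \<epsilon>)"
    using \<epsilon> by real_asymp
  ultimately show ?thesis using eventually_ge_at_top[of 16]
  proof eventually_elim
    case (elim d)
    define q where "q = nat \<lfloor>d powr (2 / 3 + \<epsilon>)\<rfloor>"
    \<comment> \<open>The divisor is \<open>64 * 3\<close>, for \<open>64 * r \<le> q\<close> with
      \<open>r = 3 * h\<close>.\<close>
    define h where "h = q div 192"
    \<comment> \<open>Half of \<open>\<epsilon>\<close> pays for the factor 192 and for rounding;
      the other half keeps \<open>h\<close> a power of \<open>d\<close> above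
      \<open>2 / 3\<close>.\<close>
    define x where "x = d powr (2 / 3 + \<epsilon> / 2)"
    have q: "real q \<le> d powr (2 / 3 + \<epsilon>)" "d powr (2 / 3 + \<epsilon>) < real q + 1"
      by (auto simp: q_def)
    have "q < 192 * (h + 1)"
      using dividend_less_times_div[of 192 q] by (simp add: h_def)
    then have "real (q + 1) \<le> real (192 * (h + 1))" by (intro of_nat_mono) simp
    then have "real q + 1 \<le> 192 * (real h + 1)" by simp
    moreover have "192 * (x + 2) \<le> d powr (2 / 3 + \<epsilon>)" using elim(6) by (simp add: x_def)
    ultimately have "192 * (x + 2) < 192 * (real h + 1)" using q(2) by (meson le_less_trans less_le_trans)
    then have hx: "x \<le> real h" by simp
    have xge: "d powr (2 / 3) \<le> x" unfolding x_def using elim \<epsilon> by (intro powr_mono) auto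
    have h: "1000 \<le> real h" using hx xge elim(4) by linarith
    \<comment> \<open>The bound on \<open>\<epsilon>\<close> keeps the exponent at most 17/24, so
      that \<open>q\<close> stays well below \<open>d\<close>.\<close>
    have "d powr (2 / 3 + \<epsilon>) \<le> d powr (3 / 4)" using elim \<epsilon> by (intro powr_mono) auto
    then have "real q \<le> d powr (3 / 4)" using q(1) by (rule order_trans[rotated])
    then have "2 * (real q + 1) \<le> 2 * (d powr (3 / 4) + 1)" by simp
    then have "2 * (real q + 1) \<le> d" using elim(1) by (rule order_trans)
    moreover have "7 * exp 1 * d * d powr (1 / 4) \<le> (real (3 * h))\<^sup>2"
    proof -
      have "d powr (4 / 3) = (d powr (2 / 3))\<^sup>2" using elim by (simp add: powr_power)
      also have "\<dots> \<le> (real h)\<^sup>2" using xge hx by (intro power_mono) auto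
      also have "\<dots> \<le> (real (3 * h))\<^sup>2" by (intro power_mono) auto
      finally show ?thesis by (rule order_trans[OF elim(2)])
    qed
    moreover have "800 * (exp 1 ^ 3 * d\<^sup>2 / real (3 * h)) \<le> (real (3 * h))\<^sup>2"
    proof -
      have "800 * exp 1 ^ 3 * d\<^sup>2 \<le> d powr (\<epsilon> / 2) * d\<^sup>2" using elim by (intro mult_right_mono) auto
      also have "\<dots> = d powr (2 + \<epsilon> / 2)" using elim by (simp add: powr_add)
      \<comment> \<open>Cubing leaves an excess of \<open>3 * \<epsilon> / 2\<close> over the
        exponent 2, more than the \<open>\<epsilon> / 2\<close> that absorbs the constants.\<close>
      also have "\<dots> \<le> d powr (3 * (2 / 3 + \<epsilon> / 2))" using elim \<epsilon> by (intro powr_mono) auto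
      also have "\<dots> = x ^ 3" unfolding x_def using elim by (simp add: powr_power)
      also have "\<dots> \<le> (real (3 * h)) ^ 3" using hx xge elim h by (intro power_mono) auto
      finally show ?thesis using h by (simp add: pos_divide_le_eq power2_eq_square power3_eq_cube mult_ac)
    qed
    moreover have "exp 1 * (exp 1 ^ 3 * d\<^sup>2 / real (3 * h))\<^sup>2 \<le> 4 ^ (h - 2)"
    proof -
      have "exp 1 * (exp 1 ^ 3 * d\<^sup>2 / real (3 * h))\<^sup>2 \<le> exp 1 * (exp 1 ^ 3 * d\<^sup>2)\<^sup>2"
      proof (intro mult_left_mono power_mono)
        have "exp 1 ^ 3 * d\<^sup>2 / real (3 * h) \<le> exp 1 ^ 3 * d\<^sup>2 / 1"
          using h by (intro divide_left_mono) auto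
        then show "exp 1 ^ 3 * d\<^sup>2 / real (3 * h) \<le> exp 1 ^ 3 * d\<^sup>2" by simp
      qed auto
      also have "\<dots> \<le> 4 powr (real h - 2)"
        using powr_mono[of "d powr (2 / 3) - 2" "real h - 2" 4] order_trans[OF xge hx]
        by (intro order_trans[OF elim(3)]) auto
      also have "real h - 2 = real (h - 2)" using h by (simp add: of_nat_diff)
      also have "4 powr real (h - 2) = 4 ^ (h - 2)" by (simp add: powr_realpow)
      finally show ?thesis .
    qed
    moreover have "192 * h \<le> q" by (simp add: h_def)
    moreover have "1000 \<le> 3 * h" using h by linarith
    ultimately show ?case using q(1) elim(7) by blast
  qed
qed

theorem theorem2:
  fixes \<delta> :: real
  assumes "\<delta> > 0"
  shows "\<exists>d\<^sub>0 :: real. \<forall>d \<ge> d\<^sub>0.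
    (\<lambda>n. measure_pmf.prob (random_hypergraph 3 n (d / real n ^ 2))
           {E. real (game_chromatic_number {1..n} E) \<le> d powr (2 / 3 + \<delta>)})
      \<longlonglongrightarrow> 1"
proof -
  \<comment> \<open>A large \<open>\<delta>\<close> is cut down first; the color bound for
    \<open>\<epsilon>\<close> implies the one for \<open>\<delta>\<close>.\<close>
  define \<epsilon> where "\<epsilon> = min \<delta> (1 / 24)"
  have "0 < \<epsilon>" "\<epsilon> \<le> 1 / 24" "\<epsilon> \<le> \<delta>" using assms by (auto simp: \<epsilon>_def)
  from eventually_parameters[OF this(1,2)] obtain d\<^sub>0 :: real where
    d0: "\<And>d. d\<^sub>0 \<le> d \<Longrightarrow> \<exists>q h :: nat. real q \<le> d powr (2 / 3 + \<epsilon>) \<and> 192 * h \<le> q \<and> 1000 \<le> 3 * h \<and>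
      16 \<le> d \<and> 2 * (real q + 1) \<le> d \<and> 7 * exp 1 * d * d powr (1 / 4) \<le> (real (3 * h))\<^sup>2 \<and>
      800 * (exp 1 ^ 3 * d\<^sup>2 / real (3 * h)) \<le> (real (3 * h))\<^sup>2 \<and>
      exp 1 * (exp 1 ^ 3 * d\<^sup>2 / real (3 * h))\<^sup>2 \<le> 4 ^ (h - 2)"
    unfolding eventually_at_top_linorder by blast
  have "(\<lambda>n. measure_pmf.prob (random_hypergraph 3 n (d / real n ^ 2))
           {E. real (game_chromatic_number {1..n} E) \<le> d powr (2 / 3 + \<delta>)}) \<longlonglongrightarrow> 1"
    if d: "d\<^sub>0 \<le> d" for d
  proof -
    obtain q h :: nat where qh: "real q \<le> d powr (2 / 3 + \<epsilon>)" "192 * h \<le> q" "1000 \<le> 3 * h" "16 \<le> d"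
      "2 * (real q + 1) \<le> d" "7 * exp 1 * d * d powr (1 / 4) \<le> (real (3 * h))\<^sup>2"
      "800 * (exp 1 ^ 3 * d\<^sup>2 / real (3 * h)) \<le> (real (3 * h))\<^sup>2"
      "exp 1 * (exp 1 ^ 3 * d\<^sup>2 / real (3 * h))\<^sup>2 \<le> 4 ^ (h - 2)"
      using d0[OF d] by blast
    define r where "r = 3 * h"
    define \<beta> where "\<beta> = d powr (1 / 4)"
    define bad where "bad n = (1 / 2) ^ n + 2 powr (- (real n / real r)) + 4 / real n" for n
    have \<beta>: "d = \<beta> ^ 4" "2 \<le> \<beta>"
    proof -
      show "d = \<beta> ^ 4" unfolding \<beta>_def using qh(4) by (simp add: powr_power)
      have "(16::real) powr (1 / 4) \<le> d powr (1 / 4)" using qh(4) by (intro powr_mono2) auto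
      moreover have "(16::real) powr (1 / 4) = 2"
        using powr_powr[of 2 4 "1 / 4 :: real"] by simp
      ultimately show "2 \<le> \<beta>" by (simp add: \<beta>_def)
    qed
    have q_le: "real q \<le> d powr (2 / 3 + \<delta>)"
    proof -
      have "d powr (2 / 3 + \<epsilon>) \<le> d powr (2 / 3 + \<delta>)" using qh(4) \<open>\<epsilon> \<le> \<delta>\<close> by (intro powr_mono) auto
      then show ?thesis using qh(1) by (rule order_trans[rotated])
    qed
    have lower: "1 - bad n \<le> measure_pmf.prob (random_hypergraph 3 n (d / real n ^ 2))
           {E. real (game_chromatic_number {1..n} E) \<le> d powr (2 / 3 + \<delta>)}"
      if n: "r \<le> n" "d \<le> real n ^ 2" for n
    proof -
      let ?M = "random_hypergraph 3 n (d / real n ^ 2)"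
      let ?W = "{E. \<exists>\<sigma>. winning_strategy_A {1..n} E q \<sigma>}"
      have "64 * r \<le> q" "1000 \<le> r" using qh(2,3) by (auto simp: r_def)
      then have "measure_pmf.prob ?M {E. \<not> (\<exists>\<sigma>. winning_strategy_A {1..n} E q \<sigma>)} \<le> bad n"
        unfolding bad_def
        using prob_A_loses_le[OF \<beta> r_def _ _ qh(5) _ refl _ _ n refl] qh(6-8) by (simp add: r_def \<beta>_def)
      also have "{E. \<not> (\<exists>\<sigma>. winning_strategy_A {1..n} E q \<sigma>)} = space (measure_pmf ?M) - ?W" by auto
      also have "measure_pmf.prob ?M (space (measure_pmf ?M) - ?W) = 1 - measure_pmf.prob ?M ?W"
        by (rule measure_pmf.prob_compl) simp
      finally have "1 - bad n \<le> measure_pmf.prob ?M ?W" by simp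
      also have "\<dots> \<le> measure_pmf.prob ?M {E. real (game_chromatic_number {1..n} E) \<le> d powr (2 / 3 + \<delta>)}"
      proof (rule measure_pmf.finite_measure_mono)
        show "?W \<subseteq> {E. real (game_chromatic_number {1..n} E) \<le> d powr (2 / 3 + \<delta>)}"
        proof
          fix E assume "E \<in> ?W"
          \<comment> \<open>A strategy for \<open>q\<close> itself bounds the least number directly,
            so monotonicity in the number of colors does not enter.\<close>
          then have "game_chromatic_number {1..n} E \<le> q"
            unfolding game_chromatic_number_def by (auto intro: Least_le)
          then show "E \<in> {E. real (game_chromatic_number {1..n} E) \<le> d powr (2 / 3 + \<delta>)}"
            using q_le by simp
        qed
      qed simp
      finally show ?thesis .
    qed
    have "(\<lambda>n. 2 powr (- (real n / x))) \<longlonglongrightarrow> 0" if "0 < x" for x :: real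
      using that by real_asymp
    from this[of "real r"] have "(\<lambda>n. 2 powr (- (real n / real r))) \<longlonglongrightarrow> 0"
      using qh(3) by (simp add: r_def)
    moreover have "(\<lambda>n. (1 / 2 :: real) ^ n) \<longlonglongrightarrow> 0" "(\<lambda>n. 4 / real n) \<longlonglongrightarrow> 0" by real_asymp+
    ultimately have "(\<lambda>n. 1 - bad n) \<longlonglongrightarrow> 1 - (0 + 0 + 0)"
      unfolding bad_def by (intro tendsto_diff tendsto_add tendsto_const)
    then have "(\<lambda>n. 1 - bad n) \<longlonglongrightarrow> 1" by simp
    moreover have "\<forall>\<^sub>F n in sequentially. 1 - bad n \<le> measure_pmf.prob (random_hypergraph 3 n (d / real n ^ 2))
           {E. real (game_chromatic_number {1..n} E) \<le> d powr (2 / 3 + \<delta>)}"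
    proof -
      have "\<forall>\<^sub>F n in sequentially. d \<le> real n ^ 2" by real_asymp
      then show ?thesis using eventually_ge_at_top[of r] by eventually_elim (rule lower)
    qed
    ultimately show ?thesis
      by (rule tendsto_sandwich[OF _ _ _ tendsto_const, rotated 2]) auto
  qed
  then show ?thesis by blast
qed

end
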